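(* Let $p>5$ be a prime. Then $$\sum_{\substack{1\leq k\leq p-1\\ k\equiv p\pmod 5}}\frac{1}{k}\equiv\frac{5^{\frac{p-1}{2}}F_{p}-1}{p}-\frac{5^{p-1}F_{2p-\left(\frac{5}{p}\right)}-1}{4p}\pmod{p^2}.$$
   Context: $F_n$ denotes the Fibonacci numbers: $F_0=0$, $F_1=1$, $F_n=F_{n-1}+F_{n-2}$ for $n\geq 2$. $\left(\frac{5}{p}\right)$ is the Legendre symbol. For rational numbers $a,b$, $a\equiv b\pmod{p^2}$ means that $(a-b)/p^2$, written in lowest terms, has denominator not divisible by $p$. *)

theory Defs
  imports "HOL-Number_Theory.Number_Theory"
begin

text \<open>Since \<^const>\<open>quotient_of\<close> yields numerator and denominator of a rational number in lowest
  terms, the second component is the reduced denominator.\<close>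

definition rat_cong_sq :: "nat \<Rightarrow> rat \<Rightarrow> rat \<Rightarrow> bool" where
  "rat_cong_sq p a b \<longleftrightarrow> \<not> int p dvd snd (quotient_of ((a - b) / of_nat (p ^ 2)))"

end

theory Submission
  imports Defs "HOL-Computational_Algebra.Polynomial"
begin

text \<open>
  Let \<open>f(x) = \<Sum> x\<^sup>k / k\<close> and \<open>f\<^sub>2(x) = \<Sum> x\<^sup>k / k\<^sup>2\<close> over \<open>0 < k < p\<close>. Filtering by fifth roots
  of unity, five times the sum in question is the sum of \<open>f(\<zeta>) / \<zeta>\<^sup>p\<close> over all \<open>\<zeta>\<close>, where
  \<open>f(1) \<equiv> 0\<close> mod \<open>p\<^sup>2\<close> by Wolstenholme. For \<open>\<zeta> \<noteq> 1\<close> the value \<open>f(\<zeta>)\<close> is, modulo \<open>p\<^sup>2\<close>,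
  \<open>p \<zeta>\<^sup>p f\<^sub>2(\<zeta>) / (1 - \<zeta>\<^sup>p)\<close> minus \<open>(1 - \<zeta>\<^sup>p) / p\<close> times the logarithm of
  \<open>u = (1 - \<zeta>)\<^sup>p / (1 - \<zeta>\<^sup>p)\<close>, which is \<open>1\<close> modulo \<open>p\<close>. The \<open>f\<^sub>2\<close> terms for \<open>\<zeta>\<close> and its inverse
  cancel to the required order. Since \<open>u\<close> is invariant under inverting \<open>\<zeta>\<close>, its square \<open>v\<close> is the
  quotient of the \<open>p\<close>-th power of \<open>\<bar>1 - \<zeta>\<bar>\<^sup>2\<close> by \<open>\<bar>1 - \<zeta>\<^sup>p\<bar>\<^sup>2\<close>. These squared moduli are roots of
  \<open>t\<^sup>2 - 5 t + 5\<close>, whose odd power sums are Fibonacci numbers times powers of 5, and expanding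
  \<open>ln u = ln v / 2\<close> to second order at \<open>v = 1\<close> gives the two terms of the formula. The Legendre
  symbol records whether \<open>\<bar>1 - \<zeta>\<^sup>p\<bar>\<^sup>2\<close> is the same root as \<open>\<bar>1 - \<zeta>\<bar>\<^sup>2\<close> or the other one.
\<close>

section \<open>Congruences modulo powers of $p$\<close>

text \<open>The localisation of the integers at \<open>p\<close>, as a subring of the complex numbers.\<close>

definition p_integral :: "nat \<Rightarrow> complex set" where
  "p_integral p = {of_int a / of_int b | a b. \<not> int p dvd b}"

text \<open>Only the difference is constrained: \<open>x\<close> and \<open>y\<close> may have
  \<open>p\<close> in their denominators, as happens after the division by \<open>p\<close> in the
  final formula.\<close>

definition p_cong :: "nat \<Rightarrow> nat \<Rightarrow> complex \<Rightarrow> complex \<Rightarrow> bool" where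
  "p_cong p k x y \<longleftrightarrow> (\<exists>t\<in>p_integral p. x = y + of_nat p ^ k * t)"

lemma p_integral_of_int [simp]: "prime p \<Longrightarrow> of_int a \<in> p_integral p"
  unfolding p_integral_def by (intro CollectI exI[of _ a] exI[of _ 1]) auto

lemma p_integral_of_nat [simp]: "prime p \<Longrightarrow> of_nat a \<in> p_integral p"
  using p_integral_of_int[of p "int a"] by simp

lemma p_integral_0 [simp]: "prime p \<Longrightarrow> 0 \<in> p_integral p"
  and p_integral_1 [simp]: "prime p \<Longrightarrow> 1 \<in> p_integral p"
  and p_integral_numeral [simp]: "prime p \<Longrightarrow> numeral n \<in> p_integral p"
  using p_integral_of_nat[of p 0] p_integral_of_nat[of p 1] p_integral_of_nat[of p "numeral n"] by simp_all

lemma p_integral_add [intro]: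
  assumes "prime p" "x \<in> p_integral p" "y \<in> p_integral p"
  shows "x + y \<in> p_integral p"
proof -
  obtain a b c d where x: "x = of_int a / of_int b" "\<not> int p dvd b"
    and y: "y = of_int c / of_int d" "\<not> int p dvd d"
    using assms unfolding p_integral_def by blast
  have nz: "b \<noteq> 0" "d \<noteq> 0" using x y by auto
  have "x + y = of_int (a * d + c * b) / of_int (b * d)"
    using nz by (simp add: x y field_simps)
  moreover have "\<not> int p dvd b * d"
    using assms(1) x y by (simp add: prime_dvd_mult_iff)
  ultimately show ?thesis unfolding p_integral_def by blast
qed

lemma p_integral_mult [intro]:
  assumes "prime p" "x \<in> p_integral p" "y \<in> p_integral p"
  shows "x * y \<in> p_integral p"
proof -
  obtain a b c d where x: "x = of_int a / of_int b" "\<not> int p dvd b"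
    and y: "y = of_int c / of_int d" "\<not> int p dvd d"
    using assms unfolding p_integral_def by blast
  have "x * y = of_int (a * c) / of_int (b * d)"
    by (simp add: x y)
  moreover have "\<not> int p dvd b * d"
    using assms(1) x y by (simp add: prime_dvd_mult_iff)
  ultimately show ?thesis unfolding p_integral_def by blast
qed

lemma p_integral_uminus [intro]:
  "prime p \<Longrightarrow> x \<in> p_integral p \<Longrightarrow> - x \<in> p_integral p"
  using p_integral_mult[of p "of_int (-1)" x] p_integral_of_int[of p "-1"] by simp

lemma p_integral_diff [intro]:
  "prime p \<Longrightarrow> x \<in> p_integral p \<Longrightarrow> y \<in> p_integral p \<Longrightarrow> x - y \<in> p_integral p"
  using p_integral_add[of p x "- y"] by auto

lemma p_integral_power [intro]:
  "prime p \<Longrightarrow> x \<in> p_integral p \<Longrightarrow> x ^ n \<in> p_integral p"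
  by (induction n) auto

lemma p_integral_sum [intro]:
  "prime p \<Longrightarrow> (\<And>i. i \<in> A \<Longrightarrow> f i \<in> p_integral p) \<Longrightarrow> sum f A \<in> p_integral p"
  by (induction A rule: infinite_finite_induct) auto

lemma p_integral_divide_of_nat [intro]:
  assumes "prime p" "x \<in> p_integral p" "\<not> p dvd n"
  shows "x / of_nat n \<in> p_integral p"
proof -
  have "of_int 1 / of_int (int n) \<in> p_integral p"
    unfolding p_integral_def using assms(3)
    by (intro CollectI exI[of _ 1] exI[of _ "int n"]) auto
  then show ?thesis
    using p_integral_mult[OF assms(1,2)] by fastforce
qed

text \<open>The bridge back to \<open>rat_cong_sq\<close>: the reduced denominator divides the
  denominator of every other representation, in particular of one whose denominator is prime to
  \<open>p\<close>.\<close>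

lemma p_integral_of_rat:
  assumes "of_rat r \<in> p_integral p"
  shows "\<not> int p dvd snd (quotient_of r)"
proof
  assume dvd: "int p dvd snd (quotient_of r)"
  obtain a b where ab: "(of_rat r :: complex) = of_int a / of_int b" "\<not> int p dvd b"
    using assms unfolding p_integral_def by blast
  have "(of_rat r :: complex) = of_rat (of_int a / of_int b)"
    by (simp add: ab of_rat_divide)
  then have "r = of_int a / of_int b"
    using of_rat_eq_iff by blast
  moreover obtain c d where cd: "quotient_of r = (c, d)" by fastforce
  ultimately have "of_int c / of_int d = (of_int a / of_int b :: rat)"
    using quotient_of_div by metis
  moreover have "d > 0" "b \<noteq> 0"
    using cd quotient_of_denom_pos ab by auto
  ultimately have "(of_int (c * b) :: rat) = of_int (a * d)"
    by (simp add: field_simps)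
  then have "c * b = a * d"
    using of_int_eq_iff by blast
  moreover have "coprime c d" using cd by (rule quotient_of_coprime)
  ultimately have "d dvd b"
    by (metis coprime_commute coprime_dvd_mult_right_iff dvd_triv_right)
  then show False using dvd cd ab by auto
qed

lemma p_congI: "t \<in> p_integral p \<Longrightarrow> x = y + of_nat p ^ k * t \<Longrightarrow> p_cong p k x y"
  unfolding p_cong_def by blast

lemma p_cong_refl [simp, intro]: "prime p \<Longrightarrow> p_cong p k x x"
  by (rule p_congI[of 0]) auto

lemma p_cong_add:
  assumes "prime p" "p_cong p k x y" "p_cong p k x' y'"
  shows "p_cong p k (x + x') (y + y')"
proof -
  obtain s t where "s \<in> p_integral p" "x = y + of_nat p ^ k * s"
      "t \<in> p_integral p" "x' = y' + of_nat p ^ k * t"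
    using assms unfolding p_cong_def by blast
  then show ?thesis
    using assms by (intro p_congI[of "s + t"]) (auto simp: algebra_simps)
qed

lemma p_cong_trans:
  assumes "prime p" "p_cong p k x y" "p_cong p k y z"
  shows "p_cong p k x z"
  using p_cong_add[OF assms] unfolding p_cong_def by (auto simp: algebra_simps)

lemma p_cong_scale:
  assumes "prime p" "p_cong p k x y" "c \<in> p_integral p"
  shows "p_cong p k (c * x) (c * y)"
proof -
  obtain t where "t \<in> p_integral p" "x = y + of_nat p ^ k * t"
    using assms unfolding p_cong_def by blast
  then show ?thesis
    using assms by (intro p_congI[of "c * t"]) (auto simp: algebra_simps)
qed

lemma p_cong_uminus:
  "prime p \<Longrightarrow> p_cong p k x y \<Longrightarrow> p_cong p k (- x) (- y)"
  using p_cong_scale[of p k x y "-1"] p_integral_of_int[of p "-1"] by simp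

lemma p_cong_diff:
  "prime p \<Longrightarrow> p_cong p k x y \<Longrightarrow> p_cong p k x' y' \<Longrightarrow> p_cong p k (x - x') (y - y')"
  using p_cong_add[of p k x y "- x'" "- y'"] p_cong_uminus[of p k x' y'] by simp

text \<open>Since x x' - y y' = x (x' - y') + y' (x - y), integrality of \<open>x\<close> and
  \<open>y'\<close> suffices.\<close>

lemma p_cong_mult:
  assumes "prime p" "p_cong p k x y" "p_cong p k x' y'" "x \<in> p_integral p" "y' \<in> p_integral p"
  shows "p_cong p k (x * x') (y * y')"
proof -
  have "p_cong p k (x * x') (x * y')" using assms by (intro p_cong_scale)
  moreover have "p_cong p k (y' * x) (y' * y)" using assms by (intro p_cong_scale)
  ultimately show ?thesis using p_cong_trans assms(1) by (simp add: mult.commute)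
qed

lemma p_cong_sum:
  "prime p \<Longrightarrow> (\<And>i. i \<in> A \<Longrightarrow> p_cong p k (f i) (g i)) \<Longrightarrow> p_cong p k (sum f A) (sum g A)"
  by (induction A rule: infinite_finite_induct) (auto intro: p_cong_add)

lemma p_cong_mult_prime:
  "p_cong p k x y \<Longrightarrow> p_cong p (Suc k) (of_nat p * x) (of_nat p * y)"
  unfolding p_cong_def by (auto simp: algebra_simps)

section \<open>Inverses modulo p and Wolstenholme's theorem\<close>

lemma inverse_p_cong:
  assumes "prime p" "\<not> p dvd m" "\<not> p dvd n" "[m = n] (mod p)"
  shows "p_cong p 1 (1 / of_nat m) (1 / of_nat n)"
proof -
  obtain k where k: "int n - int m = int p * k"
    using assms(4) by (metis cong_iff_dvd_diff cong_int_iff cong_sym dvdE)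
  have nz: "m \<noteq> 0" "n \<noteq> 0" using assms by (auto intro: ccontr)
  have "(of_nat n - of_nat m :: complex) = of_int (int n - int m)" by simp
  then have "(of_nat n - of_nat m :: complex) = of_nat p * of_int k" unfolding k by simp
  moreover have "1 / of_nat m - 1 / of_nat n = ((of_nat n - of_nat m) / of_nat m / of_nat n :: complex)"
    using nz by (simp add: field_simps)
  ultimately have "1 / of_nat m - 1 / of_nat n = (of_nat p * (of_int k / of_nat m / of_nat n) :: complex)"
    by simp
  then have eq: "1 / of_nat m = 1 / of_nat n + (of_nat p ^ 1 * (of_int k / of_nat m / of_nat n) :: complex)"
    by (simp add: algebra_simps)
  show ?thesis
    by (rule p_congI[OF _ eq])
      (use assms in \<open>intro p_integral_divide_of_nat p_integral_of_int\<close>)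
qed

lemma sum_reflect: "(\<Sum>k=1..p-1. f (p - k)) = (\<Sum>k=1..p-1. f (k::nat) :: 'a::comm_monoid_add)"
  by (rule sum.reindex_bij_witness[of _ "\<lambda>k. p - k" "\<lambda>k. p - k"]) auto

text \<open>Doubling permutes the nonzero residues, so the sum S satisfies S = S/4 modulo p. Hence 3
  S/4 vanishes modulo p, and 3 is invertible because p > 3.\<close>

lemma sum_inverse_squares_p_cong:
  assumes "prime p" "p > 3"
  shows "p_cong p 1 (\<Sum>k=1..p-1. (1 / of_nat k) ^ 2) 0"
proof -
  let ?S = "\<Sum>k=1..p-1. (1 / of_nat k :: complex) ^ 2"
  have unit: "\<not> p dvd k" if "k \<in> {1..p-1}" for k
    using that nat_dvd_not_less by force
  have odd2: "coprime 2 p" using assms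
    using prime_odd_nat by (simp add: coprime_left_2_iff_odd)
  have "bij_betw (\<lambda>k. 2 * k mod p) {1..p-1} {1..p-1}"
  proof -
    have "inj_on (\<lambda>k. 2 * k mod p) {1..p-1}"
    proof (rule inj_onI)
      fix i j assume ij: "i \<in> {1..p-1}" "j \<in> {1..p-1}" "2 * i mod p = 2 * j mod p"
      then have "[i = j] (mod p)" using odd2
        by (metis cong_def cong_mult_lcancel_nat coprime_commute)
      then show "i = j" using ij by (intro cong_less_modulus_unique_nat[of i j p]) auto
    qed
    moreover have "(\<lambda>k. 2 * k mod p) ` {1..p-1} \<subseteq> {1..p-1}"
    proof
      fix x assume "x \<in> (\<lambda>k. 2 * k mod p) ` {1..p-1}"
      then obtain k where k: "k \<in> {1..p-1}" "x = 2 * k mod p" by blast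
      have "\<not> p dvd 2 * k" using unit[OF k(1)] odd2 assms(1)
        using coprime_dvd_mult_right_iff coprime_commute by blast
      then have "x \<noteq> 0" using k by (simp add: dvd_eq_mod_eq_0)
      moreover have "x < p" using k assms by (simp add: prime_gt_0_nat)
      ultimately show "x \<in> {1..p-1}" by auto
    qed
    ultimately show ?thesis
      unfolding bij_betw_def using endo_inj_surj[of "{1..p-1}"] by blast
  qed
  then have "?S = (\<Sum>k=1..p-1. (1 / of_nat (2 * k mod p)) ^ 2)"
    using sum.reindex_bij_betw[where g = "\<lambda>k. (1 / of_nat k :: complex) ^ 2"] by metis
  moreover have "p_cong p 1 \<dots> (\<Sum>k=1..p-1. (1 / of_nat (2 * k)) ^ 2)"
  proof (rule p_cong_sum[OF assms(1)])
    fix k assume k: "k \<in> {1..p-1}"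
    have nd: "\<not> p dvd 2 * k" using unit[OF k(1)] odd2 assms(1)
      using coprime_dvd_mult_right_iff coprime_commute by blast
    then have nd': "\<not> p dvd 2 * k mod p" by (simp add: dvd_mod_iff)
    have "p_cong p 1 (1 / of_nat (2 * k mod p)) (1 / of_nat (2 * k))"
      using nd nd' assms by (intro inverse_p_cong) auto
    then show "p_cong p 1 ((1 / of_nat (2 * k mod p)) ^ 2) ((1 / of_nat (2 * k)) ^ 2)"
      unfolding power2_eq_square using assms nd nd'
      by (intro p_cong_mult p_integral_divide_of_nat p_integral_1)
  qed
  moreover have "(\<Sum>k=1..p-1. (1 / of_nat (2 * k)) ^ 2) = ?S / 4"
    by (simp add: sum_divide_distrib power_divide power_mult_distrib mult.commute)
  ultimately have "p_cong p 1 ?S (?S / 4)" by metis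
  then have "p_cong p 1 (?S - ?S / 4) (?S / 4 - ?S / 4)"
    using assms by (intro p_cong_diff p_cong_refl)
  moreover have "?S - ?S / 4 = 3 / 4 * ?S" by (simp add: field_simps)
  ultimately have 1: "p_cong p 1 (3 / 4 * ?S) 0" by simp
  have "\<not> p dvd 3" using assms by (auto dest: dvd_imp_le)
  then have "4 / of_nat 3 \<in> p_integral p" using assms by (intro p_integral_divide_of_nat) auto
  from p_cong_scale[OF assms(1) 1 this] show ?thesis by simp
qed

text \<open>Pairing k with p - k gives 2 H = p T, where T is the sum of 1 / (k (p - k)). Modulo p, T
  is minus the sum of the inverse squares, which vanishes.\<close>

lemma Wolstenholme:
  assumes "prime p" "p > 3"
  shows "p_cong p 2 (\<Sum>k=1..p-1. 1 / of_nat k) 0"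
proof -
  have unit: "\<not> p dvd k" if "k \<in> {1..p-1}" for k
    using that nat_dvd_not_less by force
  have "\<not> p dvd 2" using assms by (auto dest: dvd_imp_le)
  then have half: "1 / of_nat 2 \<in> p_integral p"
    using assms by (intro p_integral_divide_of_nat) auto
  let ?H = "\<Sum>k=1..p-1. 1 / of_nat k :: complex"
  let ?T = "\<Sum>k=1..p-1. 1 / of_nat k * (1 / of_nat (p - k)) :: complex"
  have "2 * ?H = (\<Sum>k=1..p-1. 1 / of_nat k + 1 / of_nat (p - k))"
    unfolding sum.distrib sum_reflect[of "\<lambda>k. 1 / of_nat k :: complex"] by simp
  also have "\<dots> = (\<Sum>k=1..p-1. of_nat p * (1 / of_nat k * (1 / of_nat (p - k))))"
  proof (intro sum.cong refl)
    fix k assume k: "k \<in> {1..p-1}"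
    then have "(of_nat (p - k) :: complex) = of_nat p - of_nat k" by (subst of_nat_diff) auto
    moreover have "(of_nat (p - k) :: complex) \<noteq> 0" "(of_nat k :: complex) \<noteq> 0" using k by auto
    ultimately show "1 / of_nat k + 1 / of_nat (p - k) = of_nat p * (1 / of_nat k * (1 / of_nat (p - k) :: complex))"
      by (simp add: field_simps)
  qed
  finally have "2 * ?H = of_nat p * ?T" by (simp only: sum_distrib_left)
  then have H: "?H = 1 / of_nat 2 * (of_nat p * ?T)" by (simp add: mult.commute)
  have "p_cong p 1 ?T (\<Sum>k=1..p-1. - ((1 / of_nat k) ^ 2))"
  proof (rule p_cong_sum[OF assms(1)])
    fix k assume k: "k \<in> {1..p-1}"
    then have k': "p - k \<in> {1..p-1}" by auto
    have "(1 / of_nat (p - k) :: complex) = - (1 / of_nat k) + of_nat p ^ 1 * (1 / of_nat k / of_nat (p - k))"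
    proof -
      have "(of_nat (p - k) :: complex) = of_nat p - of_nat k" using k by (subst of_nat_diff) auto
      moreover have "(of_nat (p - k) :: complex) \<noteq> 0" "(of_nat k :: complex) \<noteq> 0" using k by auto
      ultimately show ?thesis by (simp add: field_simps)
    qed
    moreover have "1 / of_nat k / of_nat (p - k) \<in> p_integral p"
      using assms(1) unit[OF k] unit[OF k'] by (intro p_integral_divide_of_nat p_integral_1)
    ultimately have "p_cong p 1 (1 / of_nat (p - k)) (- (1 / of_nat k))"
      by (intro p_congI)
    then have "p_cong p 1 (1 / of_nat k * (1 / of_nat (p - k))) (1 / of_nat k * (- (1 / of_nat k)))"
      using assms unit[OF k] by (intro p_cong_scale) auto
    then show "p_cong p 1 (1 / of_nat k * (1 / of_nat (p - k))) (- ((1 / of_nat k)\<^sup>2))"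
      by (simp add: power2_eq_square)
  qed
  moreover have "p_cong p 1 (\<Sum>k=1..p-1. - ((1 / of_nat k) ^ 2)) 0"
    using p_cong_uminus[OF assms(1) sum_inverse_squares_p_cong[OF assms]]
    by (simp add: sum_negf)
  ultimately have "p_cong p 1 ?T 0" using p_cong_trans assms by blast
  then have "p_cong p 2 (of_nat p * ?T) 0"
    using p_cong_mult_prime[of p 1 ?T 0] by (simp add: numeral_2_eq_2)
  from p_cong_scale[OF assms(1) this half] show ?thesis unfolding H by simp
qed

section \<open>The truncated logarithm\<close>

definition hsum :: "nat \<Rightarrow> complex" where
  "hsum n = (\<Sum>k=1..n. 1 / of_nat k)"

lemma hsum_0 [simp]: "hsum 0 = 0"
  by (simp add: hsum_def)

lemma hsum_Suc: "hsum (Suc n) = hsum n + 1 / of_nat (Suc n)"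
  by (simp add: hsum_def)

lemma not_dvd_less: "0 < k \<Longrightarrow> k < p \<Longrightarrow> \<not> p dvd (k::nat)"
  using nat_dvd_not_less by blast

lemma p_integral_hsum:
  "prime p \<Longrightarrow> n < p \<Longrightarrow> hsum n \<in> p_integral p"
  unfolding hsum_def
  by (intro p_integral_sum p_integral_divide_of_nat p_integral_1 not_dvd_less) auto

definition tpoly :: "nat \<Rightarrow> (nat \<Rightarrow> complex) \<Rightarrow> complex poly" where
  "tpoly p c = (\<Sum>k=1..p-1. monom (c k) k)"

lemma coeff_tpoly: "coeff (tpoly p c) m = (if 0 < m \<and> m < p then c m else 0)"
  unfolding tpoly_def by (auto simp: coeff_sum coeff_monom if_distrib cong: if_cong)

lemma poly_tpoly: "poly (tpoly p c) x = (\<Sum>k=1..p-1. c k * x ^ k)"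
  unfolding tpoly_def by (simp add: poly_sum poly_monom)

text \<open>The truncated power series of -ln (1 - x).\<close>

definition log_poly :: "nat \<Rightarrow> complex poly" where
  "log_poly p = tpoly p (\<lambda>k. 1 / of_nat k)"

definition dilog_poly :: "nat \<Rightarrow> complex poly" where
  "dilog_poly p = tpoly p (\<lambda>k. (1 / of_nat k) ^ 2)"

text \<open>Normalised so that \<open>(1 - x)\<^sup>p = 1 - x\<^sup>p - p \<cdot> binom_poly p\<close> for odd primes \<open>p\<close>.\<close>

definition binom_poly :: "nat \<Rightarrow> complex poly" where
  "binom_poly p = tpoly p (\<lambda>k. (-1) ^ (k - 1) * of_nat (p choose k) / of_nat p)"

section \<open>Coefficients of the truncated logarithm, its square and the binomial
  polynomial\<close>

lemma convolution_inverse: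
  assumes "0 < a"
  shows "(\<Sum>i=a..m-a. 1 / of_nat i * (1 / of_nat (m - i))) =
    2 / of_nat m * (\<Sum>i=a..m-a. 1 / of_nat i :: complex)"
proof -
  \<comment> \<open>Partial fractions; the two resulting sums coincide because the range is
    symmetric under i -> m - i.\<close>
  have "(\<Sum>i=a..m-a. 1 / of_nat i * (1 / of_nat (m - i)) :: complex) =
      (\<Sum>i=a..m-a. 1 / of_nat m * (1 / of_nat i + 1 / of_nat (m - i)))"
  proof (intro sum.cong refl)
    fix i assume i: "i \<in> {a..m-a}"
    then have "(of_nat (m - i) :: complex) = of_nat m - of_nat i" by (subst of_nat_diff) auto
    moreover have "(of_nat (m - i) :: complex) \<noteq> 0" "(of_nat i :: complex) \<noteq> 0" "(of_nat m :: complex) \<noteq> 0"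
      using i assms by auto
    ultimately show "1 / of_nat i * (1 / of_nat (m - i)) =
        1 / of_nat m * (1 / of_nat i + 1 / of_nat (m - i) :: complex)"
      by (simp add: field_simps)
  qed
  also have "\<dots> = 1 / of_nat m * ((\<Sum>i=a..m-a. 1 / of_nat i) + (\<Sum>i=a..m-a. 1 / of_nat (m - i)))"
    by (simp only: sum_distrib_left sum.distrib distrib_left)
  also have "(\<Sum>i=a..m-a. 1 / of_nat (m - i) :: complex) = (\<Sum>i=a..m-a. 1 / of_nat i)"
    using assms by (intro sum.reindex_bij_witness[of _ "\<lambda>i. m - i" "\<lambda>i. m - i"]) auto
  finally show ?thesis by simp
qed

lemma sum_inverse_eq_hsum_diff:
  assumes "0 < a" "a \<le> Suc b"
  shows "(\<Sum>i=a..b. 1 / of_nat i) = hsum b - hsum (a - 1)"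
  using assms(2)
proof (induction b)
  case 0
  then show ?case using assms(1) by simp
next
  case (Suc b)
  show ?case
  proof (cases "a = Suc (Suc b)")
    case False
    then have "a \<le> Suc b" using Suc.prems by simp
    with Suc.IH show ?thesis by (simp add: hsum_Suc)
  qed simp
qed

text \<open>The case m = 0 needs no separate treatment: \<open>1 / 0 = 0\<close> matches the missing
  constant term.\<close>

lemma coeff_log_poly: "coeff (log_poly p) m = (if m < p then 1 / of_nat m else 0)"
  by (simp add: log_poly_def coeff_tpoly)

lemma coeff_dilog_poly: "coeff (dilog_poly p) m = coeff (log_poly p) m ^ 2"
  by (simp add: log_poly_def dilog_poly_def coeff_tpoly)

lemma coeff_log_poly_square:
  "coeff (log_poly p * log_poly p) m =
    (if m < p then 2 / of_nat m * hsum (m - 1)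
     else if m < 2 * p then 2 / of_nat m * (hsum (p - 1) - hsum (m - p)) else 0)"
proof -
  \<comment> \<open>Both \<open>i\<close> and \<open>m - i\<close> must lie strictly between 0 and
    \<open>p\<close>. For \<open>m < p\<close> this means i starts at 1; otherwise
    \<open>m - i < p\<close> forces i to start at m - p + 1.\<close>
  define a where "a = (if m < p then 1 else m - p + 1)"
  have a: "0 < a" by (simp add: a_def)
  have "coeff (log_poly p * log_poly p) m =
      (\<Sum>i\<le>m. coeff (log_poly p) i * coeff (log_poly p) (m - i))"
    by (rule coeff_mult)
  also have "\<dots> = (\<Sum>i=a..m-a. 1 / of_nat i * (1 / of_nat (m - i)))"
    by (rule sum.mono_neutral_cong_right)
      (auto simp: a_def log_poly_def coeff_tpoly split: if_splits)
  also have "\<dots> = 2 / of_nat m * (\<Sum>i=a..m-a. 1 / of_nat i)"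
    by (rule convolution_inverse[OF a])
  also have "\<dots> = (if m < p then 2 / of_nat m * hsum (m - 1)
     else if m < 2 * p then 2 / of_nat m * (hsum (p - 1) - hsum (m - p)) else 0)"
  proof (cases "m < 2 * p")
    case True
    show ?thesis
    proof (cases "m < p")
      case True
      then show ?thesis by (simp add: a_def hsum_def)
    next
      case False
      then have "m - a = p - 1" "a - 1 = m - p" "a \<le> Suc (p - 1)"
        using True by (auto simp: a_def)
      then show ?thesis using False True a sum_inverse_eq_hsum_diff[OF a, of "p - 1"] by simp
    qed
  qed (auto simp: a_def)
  finally show ?thesis .
qed

lemma p_integral_log_poly: "prime p \<Longrightarrow> coeff (log_poly p) m \<in> p_integral p"
  unfolding log_poly_def coeff_tpoly
  by (auto intro!: p_integral_divide_of_nat not_dvd_less)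

text \<open>The left-hand side is the product of 1 - p/i over i from 1 to k, because (k + 1)
  binom(p, k + 1) / p = binom(p - 1, k). To first order in p this is 1 - p H_k; the induction adds
  one factor at a time.\<close>

lemma binomial_p_cong:
  assumes "prime p" "Suc k < p"
  shows "p_cong p 2 (of_nat (Suc k) * ((-1) ^ k * of_nat (p choose Suc k) / of_nat p))
    (1 - of_nat p * hsum k)"
  using assms(2)
proof (induction k)
  case 0
  then show ?case using assms(1) by (simp add: prime_gt_0_nat)
next
  case (Suc k)
  let ?d = "\<lambda>k. (-1) ^ k * of_nat (p choose Suc k) / of_nat p :: complex"
  have nz: "(of_nat p :: complex) \<noteq> 0" using assms(1) by auto
  have "Suc (Suc k) * (p choose Suc (Suc k)) = (p choose Suc k) * (p - Suc k)"
    using binomial_absorb_comp[of p "Suc k"] binomial_absorption[of "Suc k" p]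
    by (simp add: mult.commute)
  then have "(of_nat (Suc (Suc k)) * of_nat (p choose Suc (Suc k)) :: complex) =
      of_nat (p choose Suc k) * (of_nat p - of_nat (Suc k))"
    using Suc.prems by (metis (no_types, lifting) Suc_lessD less_imp_le_nat of_nat_diff of_nat_mult)
  then have "of_nat (Suc (Suc k)) * ?d (Suc k) =
      (-1) ^ Suc k * (of_nat (p choose Suc k) * (of_nat p - of_nat (Suc k))) / of_nat p"
    by (simp add: mult_ac)
  also have "\<dots> = (1 - of_nat p * (1 / of_nat (Suc k))) * (of_nat (Suc k) * ?d k)"
    using nz by (simp add: field_simps del: of_nat_Suc)
  finally have step: "of_nat (Suc (Suc k)) * ?d (Suc k) =
    (1 - of_nat p * (1 / of_nat (Suc k))) * (of_nat (Suc k) * ?d k)" .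
  have u: "1 / of_nat (Suc k) \<in> p_integral p"
    using assms(1) Suc.prems by (intro p_integral_divide_of_nat not_dvd_less) auto
  have "p_cong p 2 (of_nat (Suc (Suc k)) * ?d (Suc k))
    ((1 - of_nat p * (1 / of_nat (Suc k))) * (1 - of_nat p * hsum k))"
    unfolding step using Suc u assms(1)
    by (intro p_cong_scale p_integral_diff p_integral_mult) auto
  moreover have "p_cong p 2 ((1 - of_nat p * (1 / of_nat (Suc k))) * (1 - of_nat p * hsum k))
    (1 - of_nat p * hsum (Suc k))"
  proof (rule p_congI)
    show "1 / of_nat (Suc k) * hsum k \<in> p_integral p"
      using u Suc.prems assms(1) by (intro p_integral_mult p_integral_hsum) auto
  qed (auto simp: hsum_Suc algebra_simps power2_eq_square simp del: of_nat_Suc)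
  ultimately show ?case using p_cong_trans assms(1) by blast
qed

lemma log_poly_binom_poly_p_cong:
  assumes "prime p"
  shows "p_cong p 2 (coeff (log_poly p) m - coeff (binom_poly p) m)
    (of_nat p * (hsum (m - 1) * coeff (log_poly p) m))"
proof (cases "0 < m \<and> m < p")
  case True
  then obtain k where k: "m = Suc k" by (auto dest: gr0_implies_Suc)
  have u: "1 / of_nat m \<in> p_integral p"
    using assms(1) True by (intro p_integral_divide_of_nat not_dvd_less) auto
  have "p_cong p 2 (of_nat m * coeff (binom_poly p) m) (1 - of_nat p * hsum (m - 1))"
    using binomial_p_cong[OF assms, of k] True
    by (simp add: k binom_poly_def coeff_tpoly del: of_nat_Suc)
  from p_cong_scale[OF assms this u] have
    "p_cong p 2 (coeff (binom_poly p) m) (1 / of_nat m * (1 - of_nat p * hsum (m - 1)))"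
    using True by simp
  then have "p_cong p 2 (coeff (log_poly p) m - coeff (binom_poly p) m)
     (coeff (log_poly p) m - 1 / of_nat m * (1 - of_nat p * hsum (m - 1)))"
    using assms by (intro p_cong_diff p_cong_refl)
  then show ?thesis using True by (simp add: log_poly_def coeff_tpoly algebra_simps)
next
  case False
  then show ?thesis using assms by (auto simp: log_poly_def binom_poly_def coeff_tpoly)
qed

lemma hsum_coeff_log_poly_integral:
  assumes "prime p" shows "hsum (m - 1) * coeff (log_poly p) m \<in> p_integral p"
proof (cases "m < p")
  case True
  then show ?thesis using assms p_integral_hsum[of p "m - 1"] p_integral_log_poly[of p m] by auto
next
  case False
  then show ?thesis using assms by (simp add: coeff_log_poly)
qed

lemma p_cong_integral:
  "prime p \<Longrightarrow> p_cong p k x y \<Longrightarrow> y \<in> p_integral p \<Longrightarrow> x \<in> p_integral p"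
  unfolding p_cong_def by (auto intro!: p_integral_add p_integral_mult p_integral_power)

lemma p_cong_Suc_D: "prime p \<Longrightarrow> p_cong p (Suc k) x y \<Longrightarrow> p_cong p k x y"
  unfolding p_cong_def by (auto intro!: p_integral_mult bexI[of _ "of_nat p * _"])

lemma p_cong_0_scale:
  "x \<in> p_integral p \<Longrightarrow> p_cong p k (of_nat p ^ k * x) 0"
  by (rule p_congI) auto

lemma binom_poly_p_cong_log_poly:
  assumes "prime p"
  shows "p_cong p 1 (coeff (binom_poly p) m) (coeff (log_poly p) m)"
proof -
  let ?C = "coeff (log_poly p) m" and ?D = "coeff (binom_poly p) m"
  have "p_cong p 1 (?C - ?D) (of_nat p * (hsum (m - 1) * ?C))"
    using log_poly_binom_poly_p_cong[OF assms, of m] p_cong_Suc_D[OF assms, of 1]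
    by (simp add: numeral_2_eq_2)
  moreover have "p_cong p 1 (of_nat p * (hsum (m - 1) * ?C)) 0"
    using p_cong_0_scale[OF hsum_coeff_log_poly_integral[OF assms, of m], of 1] by simp
  ultimately have "p_cong p 1 (?C - ?D) 0" using p_cong_trans assms by blast
  then have "p_cong p 1 (?C - (?C - ?D)) (?C - 0)" by (intro p_cong_diff assms p_cong_refl)
  then show ?thesis by simp
qed

lemma p_integral_binom_poly: "prime p \<Longrightarrow> coeff (binom_poly p) m \<in> p_integral p"
  using p_cong_integral[OF _ binom_poly_p_cong_log_poly p_integral_log_poly] by blast

lemma not_prime_dvd_2: "prime p \<Longrightarrow> p > 3 \<Longrightarrow> \<not> p dvd (2::nat)"
  by (auto dest: dvd_imp_le)

lemma half_integral: "prime p \<Longrightarrow> p > 3 \<Longrightarrow> 1 / 2 \<in> p_integral p"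
  using p_integral_divide_of_nat[of p 1 2] not_prime_dvd_2 by simp

text \<open>For full series, the sum of H_(m-1) x^m / m is half the square of the logarithm series.
  Truncation at \<open>p\<close> leaves this intact below degree \<open>p\<close>; from there on,
  reduction modulo p produces the term shifted by \<open>p\<close>.\<close>

lemma log_poly_square_p_cong:
  assumes p: "prime p" "p > 3"
  shows "p_cong p 1 (hsum (m - 1) * coeff (log_poly p) m
      - (if m < p then 0 else hsum (m - p) * coeff (log_poly p) (m - p))
      - 1 / 2 * coeff (log_poly p * log_poly p) m) 0"
proof -
  consider "m < p" | "m = p" | r where "0 < r" "r < p" "m = p + r" | "m \<ge> 2 * p"
    by (metis add_diff_inverse_nat linorder_not_less mult_2 nat_add_left_cancel_less
        nat_neq_iff not_gr_zero add_0_right)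
  then show ?thesis
  proof cases
    case 1
    then show ?thesis using p unfolding coeff_log_poly_square coeff_log_poly by simp
  next
    case 2
    \<comment> \<open>In degree p the expression is -H_(p-1) / p, so here Wolstenholme is needed
      with its full modulus p^2.\<close>
    obtain t where "t \<in> p_integral p" and t: "hsum (p - 1) = of_nat p ^ 2 * t"
      using Wolstenholme[OF p] unfolding p_cong_def hsum_def by auto
    have "p > 0" using p by simp
    then have eq: "hsum (m - 1) * coeff (log_poly p) m
      - (if m < p then 0 else hsum (m - p) * coeff (log_poly p) (m - p))
      - 1 / 2 * coeff (log_poly p * log_poly p) m = of_nat p ^ 1 * (- t)"
      unfolding coeff_log_poly_square coeff_log_poly using 2
      by (simp add: t[unfolded One_nat_def] power2_eq_square)
    show ?thesis unfolding eq
      using p \<open>t \<in> p_integral p\<close> by (intro p_cong_0_scale p_integral_uminus)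
  next
    case 3
    have m: "\<not> p dvd m" using 3 by (auto dest: dvd_imp_le)
    have r: "\<not> p dvd r" using 3 by (auto dest: dvd_imp_le)
    have eq: "hsum (m - 1) * coeff (log_poly p) m
      - (if m < p then 0 else hsum (m - p) * coeff (log_poly p) (m - p))
      - 1 / 2 * coeff (log_poly p * log_poly p) m =
       hsum r * (1 / of_nat m - 1 / of_nat r) + - (1 / of_nat m) * hsum (p - 1)"
      unfolding coeff_log_poly_square coeff_log_poly using 3
      by (simp add: algebra_simps diff_divide_distrib)
    \<comment> \<open>Here m = p + r, so 1/m and 1/r agree modulo p and the terms with H_r
      cancel.\<close>
    have "p_cong p 1 (1 / of_nat m - 1 / of_nat r) (1 / of_nat r - 1 / of_nat r)"
      using p m r 3 by (intro p_cong_diff inverse_p_cong p_cong_refl) (auto simp: cong_def)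
    then have "p_cong p 1 (hsum r * (1 / of_nat m - 1 / of_nat r)) (hsum r * 0)"
      using p 3 by (intro p_cong_scale p_integral_hsum) auto
    moreover have "p_cong p 1 (hsum (p - 1)) 0"
      using Wolstenholme[OF p] p_cong_Suc_D[OF p(1), of 1] by (simp add: numeral_2_eq_2 hsum_def)
    then have "p_cong p 1 (- (1 / of_nat m) * hsum (p - 1)) (- (1 / of_nat m) * 0)"
      using p m by (intro p_cong_scale p_integral_uminus p_integral_divide_of_nat p_integral_1)
    ultimately have "p_cong p 1 (hsum r * (1 / of_nat m - 1 / of_nat r) + - (1 / of_nat m) * hsum (p - 1))
       (hsum r * 0 + - (1 / of_nat m) * 0)"
      using p by (intro p_cong_add)
    then show ?thesis unfolding eq by simp
  next
    case 4
    then show ?thesis using p unfolding coeff_log_poly_square coeff_log_poly by auto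
  qed
qed

text \<open>This is what remains of the logarithm of \<open>(1 - x)\<^sup>p / (1 - x\<^sup>p)\<close> after expanding it in powers
  of \<open>p\<close>.\<close>

lemma log_poly_functional_p_cong:
  assumes p: "prime p" "p > 3"
  shows "p_cong p 2 (coeff ((1 - monom 1 p) * (log_poly p - binom_poly p)
    - smult (of_nat p) (monom 1 p * dilog_poly p + smult (1 / 2) (binom_poly p * binom_poly p))) m) 0"
proof -
  let ?C = "coeff (log_poly p)" and ?D = "coeff (binom_poly p)"
  let ?E = "\<lambda>m. of_nat p * (hsum (m - 1) * ?C m)"
  let ?CC = "coeff (log_poly p * log_poly p) m" and ?DD = "coeff (binom_poly p * binom_poly p) m"
  \<comment> \<open>The quadratic term carries a factor p, so in it \<open>binom_poly\<close> may be
    replaced by \<open>log_poly\<close>, with which it agrees only modulo p.\<close>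
  have "p_cong p 1 ?DD ?CC"
    unfolding coeff_mult
    by (intro p_cong_sum p_cong_mult binom_poly_p_cong_log_poly p_integral_binom_poly
        p_integral_log_poly p)
  then have "p_cong p 1 (1 / 2 * ?DD) (1 / 2 * ?CC)"
    by (intro p_cong_scale half_integral p)
  then have 1: "p_cong p 2 (of_nat p * (1 / 2 * ?DD)) (of_nat p * (1 / 2 * ?CC))"
    using p_cong_mult_prime[of p 1 "1 / 2 * ?DD" "1 / 2 * ?CC"] by (simp add: numeral_2_eq_2)
  have 2: "p_cong p 2 (if m < p then 0 else ?C (m - p) - ?D (m - p)) (if m < p then 0 else ?E (m - p))"
    using log_poly_binom_poly_p_cong[OF p(1), of "m - p"] p by simp
  have coeff: "coeff ((1 - monom 1 p) * (log_poly p - binom_poly p)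
    - smult (of_nat p) (monom 1 p * dilog_poly p + smult (1 / 2) (binom_poly p * binom_poly p))) m
    = (?C m - ?D m) - (if m < p then 0 else ?C (m - p) - ?D (m - p))
      - of_nat p * (if m < p then 0 else ?C (m - p) ^ 2) - of_nat p * (1 / 2 * ?DD)"
    unfolding left_diff_distrib mult_1_left coeff_diff coeff_smult coeff_add coeff_monom_mult
      coeff_dilog_poly
    by (cases "m < p") (simp_all add: distrib_left)
  \<comment> \<open>The dilogarithm coefficient 1/r^2 raises H_(r-1) / r to H_r / r, which is the
    shifted term of \<open>log_poly_square_p_cong\<close>.\<close>
  have "hsum (r - 1) * ?C r + ?C r ^ 2 = hsum r * ?C r" for r
    by (cases r) (auto simp: coeff_log_poly hsum_Suc field_simps power2_eq_square simp del: of_nat_Suc)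
  then have step: "of_nat p * (hsum (r - 1) * ?C r) + of_nat p * ?C r ^ 2 = of_nat p * (hsum r * ?C r)" for r
    unfolding distrib_left[symmetric] by (rule arg_cong)
  have combine: "?E m - (if m < p then 0 else ?E (m - p))
      - of_nat p * (if m < p then 0 else ?C (m - p) ^ 2) - of_nat p * (1 / 2 * ?CC) =
      of_nat p * (hsum (m - 1) * ?C m - (if m < p then 0 else hsum (m - p) * ?C (m - p)) - 1 / 2 * ?CC)"
    using step[of "m - p"]
    by (cases "m < p")
      (simp_all only: if_True if_False right_diff_distrib distrib_left diff_diff_eq mult_zero_right
        diff_zero add.assoc)
  have *: "p_cong p 2 (coeff ((1 - monom 1 p) * (log_poly p - binom_poly p)
    - smult (of_nat p) (monom 1 p * dilog_poly p + smult (1 / 2) (binom_poly p * binom_poly p))) m)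
    (of_nat p * (hsum (m - 1) * ?C m - (if m < p then 0 else hsum (m - p) * ?C (m - p)) - 1 / 2 * ?CC))"
    unfolding coeff combine[symmetric]
    by (intro p_cong_diff p_cong_refl 1 2 log_poly_binom_poly_p_cong p)
  have "p_cong p 2 (of_nat p * (hsum (m - 1) * ?C m - (if m < p then 0 else hsum (m - p) * ?C (m - p)) - 1 / 2 * ?CC)) 0"
    using p_cong_mult_prime[OF log_poly_square_p_cong[OF p, of m]] by (simp add: numeral_2_eq_2)
  with * show ?thesis using p_cong_trans p by blast
qed

section \<open>Fifth roots of unity\<close>

lemma not_5_dvd_prime: "prime p \<Longrightarrow> p > 5 \<Longrightarrow> \<not> 5 dvd (p::nat)"
  by (auto simp: prime_nat_iff)

text \<open>Values at \<zeta> are usually irrational and thus outside \<open>p_integral\<close>.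
  Error terms are therefore kept as polynomials with integral coefficients until they are summed
  over all conjugates.\<close>

definition integral_poly :: "nat \<Rightarrow> complex poly \<Rightarrow> bool" where
  "integral_poly p q \<longleftrightarrow> (\<forall>i. coeff q i \<in> p_integral p)"

lemma integral_poly_add: "prime p \<Longrightarrow> integral_poly p q \<Longrightarrow> integral_poly p r \<Longrightarrow> integral_poly p (q + r)"
  and integral_poly_diff: "prime p \<Longrightarrow> integral_poly p q \<Longrightarrow> integral_poly p r \<Longrightarrow> integral_poly p (q - r)"
  and integral_poly_mult: "prime p \<Longrightarrow> integral_poly p q \<Longrightarrow> integral_poly p r \<Longrightarrow> integral_poly p (q * r)"
  and integral_poly_smult: "prime p \<Longrightarrow> c \<in> p_integral p \<Longrightarrow> integral_poly p q \<Longrightarrow> integral_poly p (smult c q)"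
  and integral_poly_monom: "prime p \<Longrightarrow> c \<in> p_integral p \<Longrightarrow> integral_poly p (monom c n)"
  unfolding integral_poly_def coeff_mult by auto

lemma integral_poly_power: "prime p \<Longrightarrow> integral_poly p q \<Longrightarrow> integral_poly p (q ^ n)"
  by (induction n) (auto intro: integral_poly_mult integral_poly_monom[of p 1 0, simplified])

lemma integral_poly_tpoly:
  "prime p \<Longrightarrow> (\<And>k. 0 < k \<Longrightarrow> k < p \<Longrightarrow> c k \<in> p_integral p) \<Longrightarrow> integral_poly p (tpoly p c)"
  unfolding integral_poly_def coeff_tpoly by auto

locale fifth_root =
  fixes \<zeta> :: complex
  assumes pow5: "\<zeta> ^ 5 = 1" and neq1: "\<zeta> \<noteq> 1"
begin

lemma power_mod_5: "\<zeta> ^ (n mod 5) = \<zeta> ^ n"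
proof -
  have "\<zeta> ^ n = \<zeta> ^ (5 * (n div 5) + n mod 5)" by simp
  then show ?thesis unfolding power_add power_mult pow5 by simp
qed

lemma power_cong: "[m = n] (mod 5) \<Longrightarrow> \<zeta> ^ m = \<zeta> ^ n"
  using power_mod_5[of m] power_mod_5[of n] by (simp add: cong_def)

lemma sum_powers: "1 + \<zeta> + \<zeta> ^ 2 + \<zeta> ^ 3 + \<zeta> ^ 4 = 0"
proof -
  have "(1 - \<zeta>) * (1 + \<zeta> + \<zeta> ^ 2 + \<zeta> ^ 3 + \<zeta> ^ 4) = 1 - \<zeta> ^ 5"
    by (simp add: algebra_simps eval_nat_numeral)
  then show ?thesis using pow5 neq1 by simp
qed

lemma power_eq_1_iff: "\<zeta> ^ n = 1 \<longleftrightarrow> 5 dvd n"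
proof
  assume "5 dvd n"
  then show "\<zeta> ^ n = 1" by (auto elim!: dvdE simp: power_mult pow5)
next
  assume n: "\<zeta> ^ n = 1"
  show "5 dvd n"
  proof (rule ccontr)
    assume "\<not> 5 dvd n"
    moreover have "prime (5 :: nat)" by simp
    ultimately have "coprime n 5" using prime_imp_coprime coprime_commute by blast
    then obtain m where "[n * m = 1] (mod 5)" using cong_solve_coprime_nat by auto
    then have "\<zeta> ^ (n * m) = \<zeta> ^ 1" by (rule power_cong)
    then show False using n neq1 by (simp add: power_mult)
  qed
qed

lemma fifth_root_power: "\<not> 5 dvd n \<Longrightarrow> fifth_root (\<zeta> ^ n)"
  using pow5 power_eq_1_iff by unfold_locales (auto simp flip: power_mult simp: mult.commute)

lemma sum_root_powers: "(\<Sum>j=1..4. (\<zeta> ^ j) ^ n) = (if 5 dvd n then 4 else - 1)"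
proof -
  have eq: "(\<Sum>j=1..4. (\<zeta> ^ j) ^ n) = \<zeta> ^ n + (\<zeta> ^ n) ^ 2 + (\<zeta> ^ n) ^ 3 + (\<zeta> ^ n) ^ 4"
  proof -
    have "(\<zeta> ^ j) ^ n = (\<zeta> ^ n) ^ j" for j by (simp add: mult.commute flip: power_mult)
    then show ?thesis by (simp add: eval_nat_numeral)
  qed
  show ?thesis
  proof (cases "5 dvd n")
    case True
    then have "\<zeta> ^ n = 1" using power_eq_1_iff by blast
    with True show ?thesis unfolding eq by simp
  next
    case False
    then interpret z: fifth_root "\<zeta> ^ n" by (rule fifth_root_power)
    show ?thesis unfolding eq using z.sum_powers False by (simp add: add_eq_0_iff algebra_simps)
  qed
qed

text \<open>This is a trace: each power \<zeta>^i contributes 4 or -1 after summation over the four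
  roots, so only integer multiples of the coefficients remain.\<close>

lemma sum_integral_poly:
  assumes "prime p" "integral_poly p q"
  shows "(\<Sum>j=1..4. poly q (\<zeta> ^ j)) \<in> p_integral p"
proof -
  have "(\<Sum>j=1..4. poly q (\<zeta> ^ j)) = (\<Sum>i\<le>degree q. coeff q i * (\<Sum>j=1..4. (\<zeta> ^ j) ^ i))"
    unfolding poly_altdef sum_distrib_left by (rule sum.swap)
  also have "\<dots> \<in> p_integral p"
    unfolding sum_root_powers using assms unfolding integral_poly_def
    by (intro p_integral_sum p_integral_mult) (auto intro: p_integral_uminus)
  finally show ?thesis .
qed

text \<open>Writes the inverse as a polynomial in \<zeta> with denominator 5 only, hence integral at
  every other prime.\<close>

lemma inverse_one_minus: "1 / (1 - \<zeta>) = - (1 / 5) * (\<zeta> + 2 * \<zeta> ^ 2 + 3 * \<zeta> ^ 3 + 4 * \<zeta> ^ 4)"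
proof -
  have "(1 - \<zeta>) * (\<zeta> + 2 * \<zeta> ^ 2 + 3 * \<zeta> ^ 3 + 4 * \<zeta> ^ 4) = (1 + \<zeta> + \<zeta> ^ 2 + \<zeta> ^ 3 + \<zeta> ^ 4) - 1 - 4 * \<zeta> ^ 5"
    by (simp add: algebra_simps eval_nat_numeral)
  then have "(1 - \<zeta>) * (\<zeta> + 2 * \<zeta> ^ 2 + 3 * \<zeta> ^ 3 + 4 * \<zeta> ^ 4) = - 5"
    unfolding sum_powers pow5 by simp
  then show ?thesis using neq1 by (simp add: field_simps)
qed

end

text \<open>Takes the value \<open>1 / (1 - \<zeta>\<^sup>p)\<close> at every nontrivial fifth root of unity \<open>\<zeta>\<close>.\<close>

definition inverse_poly :: "nat \<Rightarrow> complex poly" where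
  "inverse_poly p = smult (- (1 / 5)) (monom 1 p + monom 2 (2 * p) + monom 3 (3 * p) + monom 4 (4 * p))"

lemma integral_inverse_poly:
  assumes "prime p" "\<not> p dvd 5"
  shows "integral_poly p (inverse_poly p)"
proof -
  have "1 / of_nat 5 \<in> p_integral p" using assms by (intro p_integral_divide_of_nat) auto
  then have "- (1 / 5) \<in> p_integral p" using p_integral_uminus[OF assms(1)] by fastforce
  then show ?thesis unfolding inverse_poly_def using assms
    by (intro integral_poly_smult integral_poly_add integral_poly_monom) auto
qed

lemma (in fifth_root) poly_inverse_poly:
  assumes "\<not> 5 dvd p"
  shows "poly (inverse_poly p) \<zeta> = 1 / (1 - \<zeta> ^ p)"
proof -
  interpret y: fifth_root "\<zeta> ^ p" using assms by (rule fifth_root_power)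
  show ?thesis
    unfolding y.inverse_one_minus inverse_poly_def
    by (simp add: poly_monom mult.commute flip: power_mult)
qed

lemma one_minus_power_eq_binom_poly:
  assumes "prime p" "odd p"
  shows "(1 - x) ^ p = 1 - x ^ p - of_nat p * poly (binom_poly p) x"
proof -
  have p: "p > 0" using assms by (simp add: prime_gt_0_nat)
  have "(1 - x) ^ p = (- x + 1) ^ p" by simp
  also have "\<dots> = (\<Sum>k\<le>p. of_nat (p choose k) * (- x) ^ k * 1 ^ (p - k))"
    by (rule binomial_ring)
  also have "\<dots> = (\<Sum>k\<in>insert 0 (insert p {1..p-1}). of_nat (p choose k) * (- x) ^ k)"
    using p by (intro sum.cong) auto
  also have "\<dots> = 1 - x ^ p + (\<Sum>k=1..p-1. of_nat (p choose k) * (- x) ^ k)"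
    using p assms by (subst sum.insert) (auto simp: power_minus_odd)
  also have "(\<Sum>k=1..p-1. of_nat (p choose k) * (- x) ^ k) = - (of_nat p * poly (binom_poly p) x)"
    unfolding binom_poly_def poly_tpoly sum_distrib_left sum_negf[symmetric]
  proof (intro sum.cong refl)
    fix k assume "k \<in> {1..p-1}"
    then obtain j where "k = Suc j" by (cases k) auto
    then have "(-1 :: complex) ^ k = - ((-1) ^ (k - 1))" by simp
    moreover have "(- x) ^ k = (-1) ^ k * x ^ k" by (rule power_minus)
    ultimately show "of_nat (p choose k) * (- x) ^ k =
        - (of_nat p * ((-1) ^ (k - 1) * of_nat (p choose k) / of_nat p * x ^ k))"
      using p by simp
  qed
  finally show ?thesis by simp
qed

text \<open>Here \<zeta>^4 is the inverse of \<zeta>. The reflection k -> p - k, together with 1 /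
  (1 - y^(-1)) = -y / (1 - y) for y = \<zeta>^p, leaves the coefficients 1/k^2 - 1/(p - k)^2, which
  equal p (p - 2k) / (k^2 (p - k)^2).\<close>

lemma (in fifth_root) sum_reflected_dilog:
  assumes "\<not> 5 dvd p"
  shows "poly (dilog_poly p) \<zeta> / (1 - \<zeta> ^ p) + poly (dilog_poly p) (\<zeta> ^ 4) / (1 - (\<zeta> ^ 4) ^ p) =
    of_nat p * poly (inverse_poly p *
      tpoly p (\<lambda>k. (of_nat p - 2 * of_nat k) * (1 / of_nat k) ^ 2 * (1 / of_nat (p - k)) ^ 2)) \<zeta>"
proof -
  interpret y: fifth_root "\<zeta> ^ p" using assms by (rule fifth_root_power)
  have y1: "1 - \<zeta> ^ p \<noteq> 0" using y.neq1 by simp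
  have "(\<zeta> ^ 4) ^ p * \<zeta> ^ p = (\<zeta> ^ 5) ^ p" unfolding power_mult[symmetric] power_add[symmetric] by simp
  then have y4: "(\<zeta> ^ 4) ^ p * \<zeta> ^ p = 1" by (simp add: pow5)
  have y4': "1 / (1 - (\<zeta> ^ 4) ^ p) = - (\<zeta> ^ p) / (1 - \<zeta> ^ p)"
  proof -
    have "(1 - (\<zeta> ^ 4) ^ p) * \<zeta> ^ p = - (1 - \<zeta> ^ p)" using y4 by (simp add: algebra_simps)
    moreover have "(1 - (\<zeta> ^ 4) ^ p) \<noteq> 0" using calculation y1 by force
    ultimately show ?thesis using y1 by (simp add: field_simps)
  qed
  have "poly (dilog_poly p) (\<zeta> ^ 4) * \<zeta> ^ p = (\<Sum>k=1..p-1. (1 / of_nat (p - k)) ^ 2 * (\<zeta> ^ 4) ^ (p - k)) * \<zeta> ^ p"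
    unfolding dilog_poly_def poly_tpoly
    by (subst sum_reflect[of "\<lambda>k. (1 / of_nat k) ^ 2 * (\<zeta> ^ 4) ^ k", symmetric]) simp
  also have "\<dots> = (\<Sum>k=1..p-1. (1 / of_nat (p - k)) ^ 2 * \<zeta> ^ k)"
    unfolding sum_distrib_right
  proof (intro sum.cong refl)
    fix k assume k: "k \<in> {1..p-1}"
    have "4 * (p - k) + p = 5 * (p - k) + k" using k by auto
    then have "\<zeta> ^ (4 * (p - k) + p) = \<zeta> ^ (5 * (p - k) + k)" by (simp only:)
    then have "(\<zeta> ^ 4) ^ (p - k) * \<zeta> ^ p = \<zeta> ^ k"
      by (simp only: power_add power_mult pow5 power_one mult_1)
    then show "(1 / of_nat (p - k)) ^ 2 * (\<zeta> ^ 4) ^ (p - k) * \<zeta> ^ p = (1 / of_nat (p - k)) ^ 2 * \<zeta> ^ k"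
      by simp
  qed
  finally have reflect: "poly (dilog_poly p) (\<zeta> ^ 4) * \<zeta> ^ p = (\<Sum>k=1..p-1. (1 / of_nat (p - k)) ^ 2 * \<zeta> ^ k)" .
  have "poly (dilog_poly p) \<zeta> / (1 - \<zeta> ^ p) + poly (dilog_poly p) (\<zeta> ^ 4) / (1 - (\<zeta> ^ 4) ^ p) =
    1 / (1 - \<zeta> ^ p) * (poly (dilog_poly p) \<zeta> - poly (dilog_poly p) (\<zeta> ^ 4) * \<zeta> ^ p)"
  proof -
    have "poly (dilog_poly p) (\<zeta> ^ 4) / (1 - (\<zeta> ^ 4) ^ p) = poly (dilog_poly p) (\<zeta> ^ 4) * (1 / (1 - (\<zeta> ^ 4) ^ p))"
      by simp
    then show ?thesis unfolding y4' using y1 by (simp add: field_simps)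
  qed
  also have "poly (dilog_poly p) \<zeta> - poly (dilog_poly p) (\<zeta> ^ 4) * \<zeta> ^ p =
      of_nat p * poly (tpoly p (\<lambda>k. (of_nat p - 2 * of_nat k) * (1 / of_nat k) ^ 2 * (1 / of_nat (p - k)) ^ 2)) \<zeta>"
    unfolding reflect unfolding dilog_poly_def poly_tpoly sum_subtractf[symmetric] sum_distrib_left
  proof (intro sum.cong refl)
    fix k assume k: "k \<in> {1..p-1}"
    then have "(of_nat (p - k) :: complex) = of_nat p - of_nat k" by (subst of_nat_diff) auto
    moreover have "(of_nat (p - k) :: complex) \<noteq> 0" "(of_nat k :: complex) \<noteq> 0" using k by auto
    ultimately have "(1 / of_nat k) ^ 2 - (1 / of_nat (p - k)) ^ 2 =
        of_nat p * ((of_nat p - 2 * of_nat k) * (1 / of_nat k) ^ 2 * (1 / of_nat (p - k) :: complex) ^ 2)"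
      by (simp add: divide_simps) (simp add: algebra_simps power2_eq_square)
    then show "(1 / of_nat k) ^ 2 * \<zeta> ^ k - (1 / of_nat (p - k)) ^ 2 * \<zeta> ^ k =
        of_nat p * ((of_nat p - 2 * of_nat k) * (1 / of_nat k) ^ 2 * (1 / of_nat (p - k)) ^ 2 * \<zeta> ^ k)"
      by (metis (no_types, lifting) left_diff_distrib mult.assoc)
  qed
  finally show ?thesis unfolding poly_mult poly_inverse_poly[OF assms] by simp
qed

lemma (in fifth_root) sum_dilog_p_cong:
  assumes "prime p" "p > 5"
  shows "p_cong p 1 (\<Sum>j=1..4. poly (dilog_poly p) (\<zeta> ^ j) / (1 - (\<zeta> ^ j) ^ p)) 0"
proof -
  note p5 = not_5_dvd_prime[OF assms]
  let ?F = "\<lambda>z. poly (dilog_poly p) z / (1 - z ^ p)"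
  let ?q = "inverse_poly p *
      tpoly p (\<lambda>k. (of_nat p - 2 * of_nat k) * (1 / of_nat k) ^ 2 * (1 / of_nat (p - k)) ^ 2)"
  have "\<not> p dvd 5" using assms by (auto dest: dvd_imp_le)
  then have "integral_poly p ?q"
    using assms by (intro integral_poly_mult integral_inverse_poly integral_poly_tpoly
      p_integral_mult p_integral_power p_integral_divide_of_nat p_integral_diff not_dvd_less) auto
  then have int: "(\<Sum>j=1..4. poly ?q (\<zeta> ^ j)) \<in> p_integral p"
    using assms by (intro sum_integral_poly)
  \<comment> \<open>Replacing j by 5 - j inverts each root, so twice the sum consists of the
    reflected pairs just treated.\<close>
  have "(\<Sum>j=1..4. ?F (\<zeta> ^ j)) = (\<Sum>j=1..4. ?F (\<zeta> ^ (5 - j)))"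
    by (rule sum.reindex_bij_witness[of _ "\<lambda>k. 5 - k" "\<lambda>k. 5 - k"]) auto
  also have "\<dots> = (\<Sum>j=1..4. ?F ((\<zeta> ^ j) ^ 4))"
  proof (intro sum.cong refl)
    fix j :: nat assume "j \<in> {1..4}"
    then have "j \<in> {1,2,3,4}" by auto
    then have "\<zeta> ^ (5 - j) = (\<zeta> ^ j) ^ 4"
      unfolding power_mult[symmetric] by (intro power_cong) (auto simp: cong_def)
    then show "?F (\<zeta> ^ (5 - j)) = ?F ((\<zeta> ^ j) ^ 4)" by simp
  qed
  finally have "2 * (\<Sum>j=1..4. ?F (\<zeta> ^ j)) = (\<Sum>j=1..4. ?F (\<zeta> ^ j) + ?F ((\<zeta> ^ j) ^ 4))"
    unfolding sum.distrib by simp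
  also have "\<dots> = (\<Sum>j=1..4. of_nat p * poly ?q (\<zeta> ^ j))"
  proof (intro sum.cong refl)
    fix j :: nat assume "j \<in> {1..4}"
    then have "\<not> 5 dvd j" by (auto dest: dvd_imp_le)
    then interpret z: fifth_root "\<zeta> ^ j" by (rule fifth_root_power)
    show "?F (\<zeta> ^ j) + ?F ((\<zeta> ^ j) ^ 4) = of_nat p * poly ?q (\<zeta> ^ j)"
      by (rule z.sum_reflected_dilog[OF p5])
  qed
  finally have "2 * (\<Sum>j=1..4. ?F (\<zeta> ^ j)) = of_nat p * (\<Sum>j=1..4. poly ?q (\<zeta> ^ j))"
    by (simp only: sum_distrib_left)
  moreover have "a = b ^ 1 * (1 / 2 * c)" if "2 * a = b * c" for a b c :: complex
    using that by (simp add: field_simps)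
  ultimately have eq: "(\<Sum>j=1..4. ?F (\<zeta> ^ j)) = of_nat p ^ 1 * (1 / 2 * (\<Sum>j=1..4. poly ?q (\<zeta> ^ j)))"
    by blast
  show ?thesis unfolding eq
    using int half_integral[of p] assms by (intro p_cong_0_scale p_integral_mult) auto
qed

text \<open>Dividing the coefficients of the defect by p^2 turns the congruence into an exact
  identity, which can be evaluated at irrational x.\<close>

lemma log_poly_functional_equation:
  assumes p: "prime p" "p > 3"
  obtains q where "integral_poly p q"
    "\<And>x. (1 - x ^ p) * (poly (log_poly p) x - poly (binom_poly p) x) =
      of_nat p * (x ^ p * poly (dilog_poly p) x + poly (binom_poly p) x ^ 2 / 2) + of_nat p ^ 2 * poly q x"
proof -
  define P where "P = (1 - monom 1 p) * (log_poly p - binom_poly p)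
    - smult (of_nat p) (monom 1 p * dilog_poly p + smult (1 / 2) (binom_poly p * binom_poly p))"
  define q where "q = smult (1 / of_nat p ^ 2) P"
  have nz: "(of_nat p :: complex) \<noteq> 0" using p by auto
  have "coeff q m \<in> p_integral p" for m
  proof -
    obtain t where t: "t \<in> p_integral p" "coeff P m = of_nat p ^ 2 * t"
      using log_poly_functional_p_cong[OF p, of m] unfolding p_cong_def P_def by auto
    then show ?thesis using nz by (simp add: q_def)
  qed
  then have "integral_poly p q" by (simp add: integral_poly_def)
  moreover have "(1 - x ^ p) * (poly (log_poly p) x - poly (binom_poly p) x) =
      of_nat p * (x ^ p * poly (dilog_poly p) x + poly (binom_poly p) x ^ 2 / 2) + of_nat p ^ 2 * poly q x" for x
    using nz by (simp add: q_def P_def poly_monom power2_eq_square)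
  ultimately show ?thesis using that by blast
qed

section \<open>Expansion of the residue class sum\<close>

text \<open>The second-order expansion of \<open>- ln v / 2\<close> at \<open>v = 1\<close>.\<close>

definition log_approx :: "complex \<Rightarrow> complex" where
  "log_approx v = 3 / 4 - v + v ^ 2 / 4"

text \<open>With w = P g / (1 - y), \<open>log_approx ((1 - w) ^ 2)\<close> is w + w^2/2 - w^3 +
  w^4/4. Its first two terms match the functional equation divided by 1 - y; the cubic and quartic
  terms are compensated in the multiple of P^2.\<close>

lemma log_expansion_algebra:
  fixes f g d y P Q :: complex
  assumes "P \<noteq> 0" "y \<noteq> 1"
    and eq: "(1 - y) * (f - g) = P * (y * d + g ^ 2 / 2) + P ^ 2 * Q"
  shows "f = (1 - y) / P * log_approx (((1 - y - P * g) / (1 - y)) ^ 2) + P * (y * (d / (1 - y)))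
     + P ^ 2 * (Q * (1 / (1 - y)) + g ^ 3 * (1 / (1 - y)) ^ 2 - P * (1 / 4) * g ^ 4 * (1 / (1 - y)) ^ 3)"
proof -
  define e where "e = 1 / (1 - y)"
  have e: "(1 - y) * e = 1" using assms(2) by (simp add: e_def)
  have "(1 - y - P * g) / (1 - y) = 1 - P * g * e"
    using assms(2) by (simp add: e_def diff_divide_distrib)
  moreover have "log_approx ((1 - w) ^ 2) = w + w ^ 2 / 2 - w ^ 3 + w ^ 4 / 4" for w
    by (simp add: log_approx_def field_simps eval_nat_numeral)
  ultimately have L: "(1 - y) / P * log_approx (((1 - y - P * g) / (1 - y)) ^ 2) =
      (1 - y) / P * (P * g * e + (P * g * e) ^ 2 / 2 - (P * g * e) ^ 3 + (P * g * e) ^ 4 / 4)"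
    by simp
  also have "\<dots> = ((1 - y) * e) * (g + P * g ^ 2 * e / 2 - P ^ 2 * g ^ 3 * e ^ 2 + P ^ 3 * g ^ 4 * e ^ 3 / 4)"
    using assms(1) by (simp add: field_simps eval_nat_numeral)
  finally have L: "(1 - y) / P * log_approx (((1 - y - P * g) / (1 - y)) ^ 2) =
      g + P * g ^ 2 * e / 2 - P ^ 2 * g ^ 3 * e ^ 2 + P ^ 3 * g ^ 4 * e ^ 3 / 4"
    unfolding e by simp
  have "f - g = ((1 - y) * e) * (f - g)" unfolding e by simp
  also have "\<dots> = e * ((1 - y) * (f - g))" by simp
  finally have "f = g + e * (P * (y * d + g ^ 2 / 2) + P ^ 2 * Q)" unfolding eq by (simp add: algebra_simps)
  moreover have "d / (1 - y) = d * e" by (simp add: e_def)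
  ultimately show ?thesis unfolding L e_def[symmetric]
    by (simp add: algebra_simps eval_nat_numeral)
qed

context fifth_root
begin

text \<open>The factor \<zeta>^(4jp) = \<zeta>^(-jp) selects the class of p modulo 5. The root 1 is
  absent from the sum, so its contribution H_(p-1) is subtracted.\<close>

lemma sum_log_poly:
  "(\<Sum>j=1..4. ((\<zeta> ^ j) ^ p) ^ 4 * poly (log_poly p) (\<zeta> ^ j)) =
    5 * (\<Sum>k | k \<in> {1..p - 1} \<and> [k = p] (mod 5). 1 / of_nat k) - hsum (p - 1)"
proof -
  have pow: "x ^ (4 * p + k) = (x ^ p) ^ 4 * x ^ k" for x :: complex and k
    by (simp add: power_add mult.commute[of 4 p] power_mult)
  have "(\<Sum>j=1..4. ((\<zeta> ^ j) ^ p) ^ 4 * poly (log_poly p) (\<zeta> ^ j)) =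
      (\<Sum>j=1..4. \<Sum>k=1..p-1. 1 / of_nat k * (\<zeta> ^ j) ^ (4 * p + k))"
    unfolding log_poly_def poly_tpoly sum_distrib_left pow
    by (intro sum.cong refl) simp
  also have "\<dots> = (\<Sum>k=1..p-1. 1 / of_nat k * (\<Sum>j=1..4. (\<zeta> ^ j) ^ (4 * p + k)))"
    unfolding sum_distrib_left by (rule sum.swap)
  also have "\<dots> = (\<Sum>k=1..p-1. 5 * (if [k = p] (mod 5) then 1 / of_nat k else 0) - 1 / of_nat k)"
  proof (intro sum.cong refl)
    fix k
    have "[k = p] (mod 5) \<longleftrightarrow> [4 * p + k = 4 * p + p] (mod 5)"
      by (simp only: cong_add_lcancel_nat)
    moreover have "[4 * p + k = 4 * p + p] (mod 5) \<longleftrightarrow> 5 dvd 4 * p + k"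
      by (simp add: cong_def dvd_eq_mod_eq_0)
    ultimately have "5 dvd 4 * p + k \<longleftrightarrow> [k = p] (mod 5)" by blast
    then show "1 / of_nat k * (\<Sum>j=1..4. (\<zeta> ^ j) ^ (4 * p + k)) =
      5 * (if [k = p] (mod 5) then 1 / of_nat k else 0) - 1 / of_nat k"
      unfolding sum_root_powers by simp
  qed
  also have "\<dots> = 5 * (\<Sum>k=1..p-1. if [k = p] (mod 5) then 1 / of_nat k else 0) - hsum (p - 1)"
    unfolding hsum_def sum_subtractf sum_distrib_left by simp
  also have "(\<Sum>k=1..p-1. if [k = p] (mod 5) then 1 / of_nat k else 0) =
      (\<Sum>k | k \<in> {1..p - 1} \<and> [k = p] (mod 5). 1 / of_nat k :: complex)"
    by (rule sum.inter_filter[symmetric]) simp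
  finally show ?thesis .
qed

lemma sum_inverse_residue_class_p_cong:
  assumes p: "prime p" "p > 5"
  shows "p_cong p 2 (5 * (\<Sum>k | k \<in> {1..p - 1} \<and> [k = p] (mod 5). 1 / of_nat k))
    (1 / of_nat p * (\<Sum>j=1..4. (((\<zeta> ^ j) ^ p) ^ 4 - 1)
      * log_approx (((1 - \<zeta> ^ j) ^ p / (1 - (\<zeta> ^ j) ^ p)) ^ 2)))"
proof -
  note p5 = not_5_dvd_prime[OF p]
  have "\<not> p dvd 5" using p by (auto dest: dvd_imp_le)
  have "odd p" using p prime_odd_nat by simp
  have nz: "(of_nat p :: complex) \<noteq> 0" using p by auto
  obtain q where q: "integral_poly p q" and
    fe: "\<And>x. (1 - x ^ p) * (poly (log_poly p) x - poly (binom_poly p) x) =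
      of_nat p * (x ^ p * poly (dilog_poly p) x + poly (binom_poly p) x ^ 2 / 2) + of_nat p ^ 2 * poly q x"
    using log_poly_functional_equation[of p] p by auto
  \<comment> \<open>The p^2 part of \<open>log_expansion_algebra\<close> times z^(4p), with
    \<open>inverse_poly\<close> standing for 1 / (1 - z^p).\<close>
  define r where "r = monom 1 (4 * p) * (q * inverse_poly p + binom_poly p ^ 3 * inverse_poly p ^ 2
      - smult (of_nat p * (1 / of_nat 4)) (binom_poly p ^ 4 * inverse_poly p ^ 3))"
  have "\<not> p dvd 4" using p by (auto dest: dvd_imp_le)
  then have r: "integral_poly p r"
    unfolding r_def using p q \<open>\<not> p dvd 5\<close>
    by (intro integral_poly_mult integral_poly_diff integral_poly_add integral_poly_smult
      integral_poly_power integral_poly_monom integral_inverse_poly p_integral_mult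
      p_integral_divide_of_nat p_integral_of_nat p_integral_1)
      (auto simp: integral_poly_def p_integral_binom_poly)
  let ?L = "\<lambda>z. ((z ^ p) ^ 4 - 1) * log_approx (((1 - z) ^ p / (1 - z ^ p)) ^ 2)"
  \<comment> \<open>Y = z^(4p) is the inverse of y = z^p, so it turns the weight 1 - y into Y - 1
    and removes y from the dilogarithm term.\<close>
  have scale: "Y * f = 1 / P * ((Y - 1) * l) + P * d + P ^ 2 * (Y * R)"
    if "f = (1 - y) / P * l + P * (y * d) + P ^ 2 * R" "Y * y = 1" for Y f P l d R y :: complex
  proof -
    have "Y * f = 1 / P * ((Y - Y * y) * l) + P * (Y * y * d) + P ^ 2 * (Y * R)"
      by (simp add: that(1) algebra_simps diff_divide_distrib)
    then show ?thesis by (simp add: that(2))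
  qed
  have "(z ^ p) ^ 4 * poly (log_poly p) z = 1 / of_nat p * ?L z
      + of_nat p * (poly (dilog_poly p) z / (1 - z ^ p)) + of_nat p ^ 2 * poly r z"
    if z: "fifth_root z" for z
  proof -
    interpret z: fifth_root z by (rule z)
    interpret y: fifth_root "z ^ p" using p5 by (rule z.fifth_root_power)
    have y5: "(z ^ p) ^ 4 * z ^ p = 1" using y.pow5 by (simp add: eval_nat_numeral mult_ac)
    have "poly (log_poly p) z = (1 - z ^ p) / of_nat p * log_approx (((1 - z) ^ p / (1 - z ^ p)) ^ 2)
      + of_nat p * (z ^ p * (poly (dilog_poly p) z / (1 - z ^ p)))
      + of_nat p ^ 2 * (poly q z * (1 / (1 - z ^ p)) + poly (binom_poly p) z ^ 3 * (1 / (1 - z ^ p)) ^ 2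
        - of_nat p * (1 / 4) * poly (binom_poly p) z ^ 4 * (1 / (1 - z ^ p)) ^ 3)"
      unfolding one_minus_power_eq_binom_poly[OF p(1) \<open>odd p\<close>, of z]
      by (rule log_expansion_algebra[OF nz y.neq1 fe])
    from scale[OF this y5] have "(z ^ p) ^ 4 * poly (log_poly p) z = 1 / of_nat p * ?L z
      + of_nat p * (poly (dilog_poly p) z / (1 - z ^ p))
      + of_nat p ^ 2 * ((z ^ p) ^ 4 * (poly q z * (1 / (1 - z ^ p)) + poly (binom_poly p) z ^ 3 * (1 / (1 - z ^ p)) ^ 2
        - of_nat p * (1 / 4) * poly (binom_poly p) z ^ 4 * (1 / (1 - z ^ p)) ^ 3))" .
    moreover have "poly r z = (z ^ p) ^ 4 * (poly q z * (1 / (1 - z ^ p)) + poly (binom_poly p) z ^ 3 * (1 / (1 - z ^ p)) ^ 2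
        - of_nat p * (1 / 4) * poly (binom_poly p) z ^ 4 * (1 / (1 - z ^ p)) ^ 3)"
      unfolding r_def poly_mult poly_diff poly_add poly_smult poly_power poly_monom
        z.poly_inverse_poly[OF p5]
      by (simp add: mult.assoc mult.commute[of 4 p] power_mult)
    ultimately show ?thesis by simp
  qed
  moreover have "fifth_root (\<zeta> ^ j)" if "j \<in> {1..4}" for j
    using that by (intro fifth_root_power) (auto dest: dvd_imp_le)
  ultimately have "(\<Sum>j=1..4. ((\<zeta> ^ j) ^ p) ^ 4 * poly (log_poly p) (\<zeta> ^ j)) =
     (\<Sum>j=1..4. 1 / of_nat p * ?L (\<zeta> ^ j)
      + of_nat p * (poly (dilog_poly p) (\<zeta> ^ j) / (1 - (\<zeta> ^ j) ^ p)) + of_nat p ^ 2 * poly r (\<zeta> ^ j))"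
    by (intro sum.cong refl) blast
  also have "\<dots> = 1 / of_nat p * (\<Sum>j=1..4. ?L (\<zeta> ^ j))
      + of_nat p * (\<Sum>j=1..4. poly (dilog_poly p) (\<zeta> ^ j) / (1 - (\<zeta> ^ j) ^ p))
      + of_nat p ^ 2 * (\<Sum>j=1..4. poly r (\<zeta> ^ j))"
    by (simp only: sum.distrib sum_distrib_left)
  finally have eq: "5 * (\<Sum>k | k \<in> {1..p - 1} \<and> [k = p] (mod 5). 1 / of_nat k) =
      1 / of_nat p * (\<Sum>j=1..4. ?L (\<zeta> ^ j))
      + of_nat p * (\<Sum>j=1..4. poly (dilog_poly p) (\<zeta> ^ j) / (1 - (\<zeta> ^ j) ^ p))
      + of_nat p ^ 2 * (\<Sum>j=1..4. poly r (\<zeta> ^ j)) + hsum (p - 1)"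
    unfolding sum_log_poly by (simp only: diff_eq_eq)
  have "p_cong p 2 (1 / of_nat p * (\<Sum>j=1..4. ?L (\<zeta> ^ j))
      + of_nat p * (\<Sum>j=1..4. poly (dilog_poly p) (\<zeta> ^ j) / (1 - (\<zeta> ^ j) ^ p))
      + of_nat p ^ 2 * (\<Sum>j=1..4. poly r (\<zeta> ^ j)) + hsum (p - 1))
      (1 / of_nat p * (\<Sum>j=1..4. ?L (\<zeta> ^ j)) + 0 + 0 + 0)"
  proof (intro p_cong_add p_cong_refl p(1))
    show "p_cong p 2 (of_nat p * (\<Sum>j=1..4. poly (dilog_poly p) (\<zeta> ^ j) / (1 - (\<zeta> ^ j) ^ p))) 0"
      using p_cong_mult_prime[OF sum_dilog_p_cong[OF p]] by (simp add: numeral_2_eq_2)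
    show "p_cong p 2 (of_nat p ^ 2 * (\<Sum>j=1..4. poly r (\<zeta> ^ j))) 0"
      using p r by (intro p_cong_0_scale sum_integral_poly)
    show "p_cong p 2 (hsum (p - 1)) 0"
      using Wolstenholme p unfolding hsum_def by simp
  qed
  then show ?thesis unfolding eq by simp
qed

section \<open>Squared chord lengths of the regular pentagon\<close>

lemma power_shift: "\<zeta> ^ (k + 5 * m) = \<zeta> ^ k"
  by (simp add: power_add power_mult pow5)

text \<open>This is the squared modulus of 1 - \<zeta>^k, since \<zeta>^(4k) is the conjugate of
  \<zeta>^k.\<close>

definition chord :: "nat \<Rightarrow> complex" where
  "chord k = 2 - \<zeta> ^ k - \<zeta> ^ (4 * k)"

lemma chord_mod: "chord (k mod 5) = chord k"
proof -
  have "\<zeta> ^ (4 * (k mod 5)) = \<zeta> ^ (4 * k)"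
    by (rule power_cong) (simp add: cong_def mod_mult_right_eq)
  then show ?thesis unfolding chord_def power_mod_5 by simp
qed

lemma chord_4: "chord 4 = chord 1" and chord_3: "chord 3 = chord 2"
proof -
  have "\<zeta> ^ 16 = \<zeta> ^ 1" "\<zeta> ^ 12 = \<zeta> ^ 2" "\<zeta> ^ 8 = \<zeta> ^ 3"
    by (rule power_cong; simp add: cong_def)+
  then show "chord 4 = chord 1" "chord 3 = chord 2" by (simp_all add: chord_def)
qed

lemma one_minus_square: "(1 - \<zeta> ^ k) ^ 2 = - (\<zeta> ^ k * chord k)"
proof -
  have "\<zeta> ^ k * \<zeta> ^ (4 * k) = (\<zeta> ^ 5) ^ k" by (simp flip: power_add power_mult)
  then show ?thesis by (simp add: chord_def pow5 power2_eq_square algebra_simps)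
qed

lemma chord_sum: "chord 1 + chord 2 = 5"
  and chord_prod: "chord 1 * chord 2 = 5"
proof -
  have "\<zeta> ^ 8 = \<zeta> ^ 3" by (rule power_cong) (simp add: cong_def)
  then have c: "chord 1 = 2 - \<zeta> - \<zeta> ^ 4" "chord 2 = 2 - \<zeta> ^ 2 - \<zeta> ^ 3"
    by (simp_all add: chord_def)
  show "chord 1 + chord 2 = 5" unfolding c using sum_powers by (simp add: algebra_simps add_eq_0_iff)
  have "\<zeta> ^ 6 = \<zeta>" "\<zeta> ^ 7 = \<zeta> ^ 2" using power_shift[of 1 1] power_shift[of 2 1] by simp_all
  moreover have "chord 1 * chord 2 = 4 - 2 * (\<zeta> + \<zeta> ^ 2 + \<zeta> ^ 3 + \<zeta> ^ 4) + (\<zeta> ^ 3 + \<zeta> ^ 4 + \<zeta> ^ 6 + \<zeta> ^ 7)"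
    unfolding c by (simp add: algebra_simps eval_nat_numeral)
  moreover have s: "\<zeta> + \<zeta> ^ 2 + \<zeta> ^ 3 + \<zeta> ^ 4 = - 1"
    using sum_powers by (simp add: algebra_simps add_eq_0_iff)
  moreover have "\<zeta> ^ 3 + \<zeta> ^ 4 + \<zeta> + \<zeta> ^ 2 = - 1" using s by (simp add: add_ac)
  ultimately show "chord 1 * chord 2 = 5" by simp
qed

text \<open>By \<open>one_minus_square\<close> and the oddness of p, numerator and denominator share
  the factor -\<zeta>^(jp), which cancels.\<close>

lemma squared_ratio_eq_chord:
  assumes "odd p"
  shows "((1 - \<zeta> ^ j) ^ p / (1 - (\<zeta> ^ j) ^ p)) ^ 2 = chord j ^ p / chord (j * p)"
proof -
  have "((1 - \<zeta> ^ j) ^ p) ^ 2 = ((1 - \<zeta> ^ j) ^ 2) ^ p" by (simp add: mult.commute flip: power_mult)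
  also have "\<dots> = - ((\<zeta> ^ j) ^ p * chord j ^ p)"
    unfolding one_minus_square using assms by (simp add: power_minus_odd power_mult_distrib)
  moreover have "(1 - (\<zeta> ^ j) ^ p) ^ 2 = - ((\<zeta> ^ j) ^ p * chord (j * p))"
    using one_minus_square[of "j * p"] by (simp add: power_mult)
  moreover have "\<zeta> \<noteq> 0" using pow5 by auto
  ultimately show ?thesis unfolding power_divide by simp
qed

text \<open>Inverse roots, j = 1, 4 and j = 2, 3, have the same logarithm, and their weights add up
  to minus a chord.\<close>

lemma sum_log_approx_eq_chord:
  assumes "odd p"
  shows "(\<Sum>j=1..4. (((\<zeta> ^ j) ^ p) ^ 4 - 1)
      * log_approx (((1 - \<zeta> ^ j) ^ p / (1 - (\<zeta> ^ j) ^ p)) ^ 2)) =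
    - (chord p * log_approx (chord 1 ^ p / chord p) + chord (2 * p) * log_approx (chord 2 ^ p / chord (2 * p)))"
proof -
  have sym: "chord (4 * k) = chord k" for k
  proof -
    have "\<zeta> ^ (4 * (4 * k)) = \<zeta> ^ k" using power_shift[of k "3 * k"] by simp
    then show ?thesis by (simp add: chord_def)
  qed
  have mod3: "3 * p mod 5 = 4 * (2 * p) mod 5"
    using mod_mult_self2[of "3 * p" 5 p] by simp
  have c3: "chord (3 * p) = chord (2 * p)"
    using sym[of "2 * p"] chord_mod mod3 by metis
  have pow: "((\<zeta> ^ j) ^ p) ^ 4 = \<zeta> ^ (4 * (j * p))" for j
    by (simp add: mult_ac flip: power_mult)
  have pow4: "\<zeta> ^ (16 * p) = \<zeta> ^ p" and pow3: "\<zeta> ^ (12 * p) = \<zeta> ^ (2 * p)"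
    using power_shift[of p "3 * p"] power_shift[of "2 * p" "2 * p"] by simp_all
  have "{1..4} = {1, 2, 3, 4 :: nat}" by auto
  then have "(\<Sum>j=1..4. (((\<zeta> ^ j) ^ p) ^ 4 - 1)
      * log_approx (((1 - \<zeta> ^ j) ^ p / (1 - (\<zeta> ^ j) ^ p)) ^ 2)) =
    ((\<zeta> ^ (4 * p) - 1) + (\<zeta> ^ p - 1)) * log_approx (chord 1 ^ p / chord p) +
    ((\<zeta> ^ (4 * (2 * p)) - 1) + (\<zeta> ^ (2 * p) - 1)) * log_approx (chord 2 ^ p / chord (2 * p))"
    unfolding squared_ratio_eq_chord[OF assms] pow
    by (simp add: chord_4[unfolded One_nat_def] chord_3 c3 pow3 pow4 sym) (simp add: left_diff_distrib distrib_right)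
  also have "(\<zeta> ^ (4 * p) - 1) + (\<zeta> ^ p - 1) = - chord p" by (simp add: chord_def)
  also have "(\<zeta> ^ (4 * (2 * p)) - 1) + (\<zeta> ^ (2 * p) - 1) = - chord (2 * p)" by (simp add: chord_def)
  finally show ?thesis by simp
qed

text \<open>Up to sign there are two nonzero classes modulo 5; multiplication by p fixes both or
  swaps them.\<close>

lemma chord_multiple_cases:
  "p mod 5 = 1 \<or> p mod 5 = 4 \<Longrightarrow> chord p = chord 1 \<and> chord (2 * p) = chord 2"
  "p mod 5 = 2 \<or> p mod 5 = 3 \<Longrightarrow> chord p = chord 2 \<and> chord (2 * p) = chord 1"
proof -
  have m: "chord p = chord (p mod 5)" "chord (2 * p) = chord (2 * (p mod 5) mod 5)"
    by (simp_all add: chord_mod mod_mult_right_eq)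
  show "p mod 5 = 1 \<or> p mod 5 = 4 \<Longrightarrow> chord p = chord 1 \<and> chord (2 * p) = chord 2"
    unfolding m using chord_4 chord_3 by auto
  show "p mod 5 = 2 \<or> p mod 5 = 3 \<Longrightarrow> chord p = chord 2 \<and> chord (2 * p) = chord 1"
    unfolding m using chord_4 chord_3 by auto
qed

end

section \<open>Fibonacci numbers and the Legendre symbol\<close>

lemma odd_power_sum_fib:
  fixes a b :: complex
  assumes "a + b = 5" "a * b = 5"
  shows "a ^ (2 * m + 1) + b ^ (2 * m + 1) = 5 ^ (m + 1) * of_nat (fib (2 * m + 1))"
proof -
  \<comment> \<open>The roots are sqrt 5 times the golden ratio and sqrt 5 times its inverse, which
    explains the Fibonacci numbers. The proof needs only the recurrence given by their sum and
    product.\<close>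
  define s where "s n = a ^ n + b ^ n" for n
  have rec: "s (Suc (Suc n)) = 5 * (s (Suc n) - s n)" for n
  proof -
    have "(a + b) * s (Suc n) - (a * b) * s n = s (Suc (Suc n))"
      by (simp add: s_def algebra_simps)
    then show ?thesis by (simp add: assms algebra_simps)
  qed
  have s0: "s 0 = 2" and s1: "s (Suc 0) = 5" by (simp_all add: s_def assms)
  \<comment> \<open>The recurrence has two terms, so the even power sums are carried along; their
    factor F_(2m+1) + F_(2m+3) is the Lucas number of index 2m + 2.\<close>
  have "s (2 * m + 1) = 5 ^ (m + 1) * of_nat (fib (2 * m + 1)) \<and>
    s (2 * m + 2) = 5 ^ (m + 1) * of_nat (fib (2 * m + 1) + fib (2 * m + 3))"
  proof (induction m)
    case 0
    show ?case by (simp add: s0 s1 rec eval_nat_numeral)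
  next
    case (Suc m)
    have f: "fib (2 * Suc m + 1) = fib (2 * m + 3)"
      "int (fib (2 * Suc m + 3)) = 3 * int (fib (2 * m + 3)) - int (fib (2 * m + 1))"
      by (simp_all add: eval_nat_numeral)
    have f2: "(of_nat (fib (2 * Suc m + 3)) :: complex) = 3 * of_nat (fib (2 * m + 3)) - of_nat (fib (2 * m + 1))"
      using arg_cong[OF f(2), of "of_int :: int \<Rightarrow> complex"] by simp
    have s1: "s (2 * Suc m + 1) = 5 * (s (2 * m + 2) - s (2 * m + 1))"
      and s2: "s (2 * Suc m + 2) = 5 * (s (2 * Suc m + 1) - s (2 * m + 2))"
      using rec[of "2 * m + 1"] rec[of "2 * m + 2"] by (simp_all add: eval_nat_numeral)
    have s1': "s (2 * Suc m + 1) = 5 ^ (Suc m + 1) * of_nat (fib (2 * Suc m + 1))"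
      unfolding s1 f(1) using Suc.IH by (simp add: algebra_simps)
    moreover have "s (2 * Suc m + 2) = 5 ^ (Suc m + 1) * of_nat (fib (2 * Suc m + 1) + fib (2 * Suc m + 3))"
      unfolding s2 s1' of_nat_add f2 unfolding f(1) using Suc.IH by (simp add: algebra_simps)
    ultimately show ?case by blast
  qed
  then show ?thesis by (simp add: s_def)
qed

lemma QuadRes_5_iff: "QuadRes 5 a \<longleftrightarrow> a mod 5 \<in> {0, 1, 4}"
proof
  assume "QuadRes 5 a"
  then obtain y where y: "y ^ 2 mod 5 = a mod 5" by (auto simp: QuadRes_def cong_def)
  then have a: "a mod 5 = (y mod 5) ^ 2 mod 5" by (simp add: power_mod)
  have "0 \<le> y mod 5" "y mod 5 < 5" by simp_all
  then consider "y mod 5 = 0" | "y mod 5 = 1" | "y mod 5 = 2" | "y mod 5 = 3" | "y mod 5 = 4"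
    by linarith
  then show "a mod 5 \<in> {0, 1, 4}" unfolding a by cases simp_all
next
  assume "a mod 5 \<in> {0, 1, 4}"
  then consider "a mod 5 = 0" | "a mod 5 = 1" | "a mod 5 = 4" by blast
  then have "\<exists>y. y ^ 2 mod 5 = a mod 5"
  proof cases
    case 1
    then show ?thesis by (intro exI[of _ 0]) simp
  next
    case 2
    then show ?thesis by (intro exI[of _ 1]) simp
  next
    case 3
    then show ?thesis by (intro exI[of _ 2]) simp
  qed
  then show "QuadRes 5 a" by (simp add: QuadRes_def cong_def)
qed

text \<open>As (5 - 1) / 2 is even, reciprocity has sign 1 and the symbol can be read off from the
  squares modulo 5.\<close>

lemma Legendre_5:
  assumes "prime p" "p > 5"
  shows "Legendre 5 (int p) = (if p mod 5 = 1 \<or> p mod 5 = 4 then 1 else - 1)"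
proof -
  note p5 = not_5_dvd_prime[OF assms]
  have L: "Legendre (int p) 5 = (if p mod 5 = 1 \<or> p mod 5 = 4 then 1 else - 1)"
  proof -
    have m: "int p mod 5 = int (p mod 5)" by (simp add: zmod_int)
    have "p mod 5 < 5" "p mod 5 \<noteq> 0" using p5 by (auto simp: dvd_eq_mod_eq_0)
    then consider "p mod 5 = 1" | "p mod 5 = 2" | "p mod 5 = 3" | "p mod 5 = 4" by linarith
    then show ?thesis unfolding Legendre_def QuadRes_5_iff cong_def m by cases simp_all
  qed
  have "Legendre (int p) (int 5) * Legendre (int 5) (int p) = (-1) ^ ((p - 1) div 2 * ((5 - 1) div 2))"
    using assms by (intro Quadratic_Reciprocity) auto
  then have "Legendre (int p) 5 * Legendre 5 (int p) = 1" by (simp add: power_mult mult.commute)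
  then show ?thesis unfolding L by (auto split: if_splits)
qed

text \<open>The quadratic term of \<open>log_approx\<close> yields (c^p)^2 / d for chords c and d.
  This is c^(2p-1) if d = c, and c^(2p+1) / 5 if d is the other chord, as then c d = 5; the Legendre
  symbol separates the two cases.\<close>

lemma (in fifth_root) sum_log_approx_eq_fib:
  assumes "prime p" "p > 5"
  shows "(\<Sum>j=1..4. (((\<zeta> ^ j) ^ p) ^ 4 - 1)
      * log_approx (((1 - \<zeta> ^ j) ^ p / (1 - (\<zeta> ^ j) ^ p)) ^ 2)) =
    5 * (5 ^ ((p - 1) div 2) * of_nat (fib p)) - 15 / 4
      - 5 / 4 * (5 ^ (p - 1) * of_nat (fib (nat (2 * int p - Legendre 5 (int p)))))"
proof -
  note p5 = not_5_dvd_prime[OF assms]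
  have "odd p" using assms prime_odd_nat by simp
  let ?a = "chord 1" and ?b = "chord 2"
  let ?F = "of_nat (fib (nat (2 * int p - Legendre 5 (int p)))) :: complex"
  note ab = chord_sum chord_prod
  have nz: "?a \<noteq> 0" "?b \<noteq> 0" using chord_prod by auto
  have scaled: "c * log_approx (d / c) = 3 / 4 * c - d + d ^ 2 / c / 4" if "c \<noteq> 0" for c d
    using that by (simp add: log_approx_def field_simps power2_eq_square)
  have "p = 2 * ((p - 1) div 2) + 1" using \<open>odd p\<close> by (simp add: odd_two_times_div_two_succ)
  then have sp: "?a ^ p + ?b ^ p = 5 * (5 ^ ((p - 1) div 2) * of_nat (fib p))"
    using odd_power_sum_fib[OF ab, of "(p - 1) div 2"] by simp
  obtain k where k: "p = Suc k" using assms by (cases p) auto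
  show ?thesis
  proof (cases "p mod 5 = 1 \<or> p mod 5 = 4")
    case True
    then have "nat (2 * int p - Legendre 5 (int p)) = 2 * k + 1"
      using Legendre_5[OF assms] by (simp add: k nat_add_distrib)
    then have s: "?a ^ (2 * k + 1) + ?b ^ (2 * k + 1) = 5 * (5 ^ (p - 1) * ?F)"
      using odd_power_sum_fib[OF ab, of k] by (simp add: k)
    have q: "(c ^ p) ^ 2 / c = c ^ (2 * k + 1)" if "c \<noteq> 0" for c :: complex
      using that by (simp add: k power2_eq_square mult_2 power_add)
    have "?a * log_approx (?a ^ p / ?a) + ?b * log_approx (?b ^ p / ?b) =
      3 / 4 * (?a + ?b) - (?a ^ p + ?b ^ p) + (?a ^ (2 * k + 1) + ?b ^ (2 * k + 1)) / 4"
      unfolding scaled[OF nz(1)] scaled[OF nz(2)] q[OF nz(1)] q[OF nz(2)] by (simp add: field_simps)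
    then show ?thesis
      unfolding sum_log_approx_eq_chord[OF \<open>odd p\<close>] using chord_multiple_cases(1)[OF True]
      by (simp only: ab sp s) simp
  next
    case False
    then have mod5: "p mod 5 = 2 \<or> p mod 5 = 3" using p5 by presburger
    have "nat (2 * int p - Legendre 5 (int p)) = 2 * p + 1"
      using Legendre_5[OF assms] False by (simp add: nat_add_distrib nat_mult_distrib)
    \<comment> \<open>The power sum has the factor 5^(p+1) = 25 * 5^(p-1); dividing by 20 then gives
      the same coefficient 5/4 as in the first case.\<close>
    then have s: "?a ^ (2 * p + 1) + ?b ^ (2 * p + 1) = 25 * (5 ^ (p - 1) * ?F)"
      using odd_power_sum_fib[OF ab, of p] by (simp add: k)
    have q: "(c ^ p) ^ 2 / d = c ^ (2 * p + 1) / 5" if "d \<noteq> 0" "c * d = 5" for c d :: complex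
    proof -
      have "c \<noteq> 0" using that by auto
      then have "(c ^ p) ^ 2 / d = (c ^ p) ^ 2 * c / (c * d)" by simp
      also have "(c ^ p) ^ 2 * c = c ^ (2 * p + 1)" by (simp add: mult.commute flip: power_mult)
      finally show ?thesis using that by simp
    qed
    have "?b * log_approx (?a ^ p / ?b) + ?a * log_approx (?b ^ p / ?a) =
      3 / 4 * (?a + ?b) - (?a ^ p + ?b ^ p) + (?a ^ (2 * p + 1) + ?b ^ (2 * p + 1)) / 20"
      unfolding scaled[OF nz(1)] scaled[OF nz(2)] q[OF nz(2) chord_prod]
        q[OF nz(1) chord_prod[unfolded mult.commute[of ?a]]] by (simp add: field_simps)
    then show ?thesis
      unfolding sum_log_approx_eq_chord[OF \<open>odd p\<close>] using chord_multiple_cases(2)[OF mod5]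
      by (simp only: ab sp s) simp
  qed
qed

section \<open>Transfer of the congruence to the rational numbers\<close>

theorem theorem1p3:
  fixes p :: nat
  assumes "prime p" and "p > 5"
  shows "rat_cong_sq p
    (\<Sum>k | k \<in> {1..p - 1} \<and> [k = p] (mod 5). 1 / of_nat k)
    ((5 ^ ((p - 1) div 2) * of_nat (fib p) - 1) / of_nat p
      - (5 ^ (p - 1) * of_nat (fib (nat (2 * int p - Legendre 5 (int p)))) - 1) / (4 * of_nat p))"
    (is "rat_cong_sq p ?S ?R")
proof -
  have "cis (2 * pi / 5) ^ 5 = 1" by (simp add: DeMoivre)
  moreover have "cis (2 * pi / 5) \<noteq> 1"
  proof
    assume "cis (2 * pi / 5) = 1"
    then have "sin (2 * pi / 5) = 0" by (simp add: complex_eq_iff)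
    moreover have "sin (2 * pi / 5) > 0" by (rule sin_gt_zero) auto
    ultimately show False by simp
  qed
  ultimately interpret fifth_root "cis (2 * pi / 5)" by unfold_locales
  have nz: "p > 0" using assms by simp
  have "\<not> p dvd 5" using assms by (auto dest: dvd_imp_le)
  then have fifth: "1 / of_nat 5 \<in> p_integral p"
    using assms by (intro p_integral_divide_of_nat) auto
  have S: "of_rat ?S = (\<Sum>k | k \<in> {1..p - 1} \<and> [k = p] (mod 5). 1 / of_nat k :: complex)"
    by (simp add: of_rat_sum of_rat_divide)
  \<comment> \<open>The two constants of the formula combine to -1/p + 1/(4p) = -3/(4p), a fifth of
    -15/(4p).\<close>
  have R: "of_rat ?R = 1 / of_nat 5 * (1 / of_nat p * (5 * (5 ^ ((p - 1) div 2) * of_nat (fib p)) - 15 / 4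
      - 5 / 4 * (5 ^ (p - 1) * of_nat (fib (nat (2 * int p - Legendre 5 (int p)))))) :: complex)"
    using nz by (simp add: of_rat_diff of_rat_divide of_rat_mult of_rat_power)
      (simp add: field_simps)
  have "p_cong p 2 (5 * of_rat ?S) (1 / of_nat p * (5 * (5 ^ ((p - 1) div 2) * of_nat (fib p)) - 15 / 4
      - 5 / 4 * (5 ^ (p - 1) * of_nat (fib (nat (2 * int p - Legendre 5 (int p)))))))"
    using sum_inverse_residue_class_p_cong[OF assms] unfolding sum_log_approx_eq_fib[OF assms] S .
  from p_cong_scale[OF assms(1) this fifth] have "p_cong p 2 (of_rat ?S) (of_rat ?R)"
    unfolding R by simp
  then obtain t :: complex where t: "t \<in> p_integral p" "of_rat ?S = of_rat ?R + of_nat p ^ 2 * t"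
    unfolding p_cong_def by blast
  have "of_rat ((?S - ?R) / of_nat (p ^ 2)) = t"
    unfolding of_rat_divide of_rat_diff t(2) using nz by (simp add: of_rat_power)
  then show ?thesis
    unfolding rat_cong_sq_def using t(1) by (intro p_integral_of_rat) simp
qed

end
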